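(* Let $X$ be a Banach space which is a subspace of $\mathrm{Hol}(\mathbb{D})$ with continuous inclusion, such that: (i) $e_0\in X$; (ii) if $f,f_1\in\mathrm{Hol}(\mathbb{D})$ with $f=e_1f_1$, then $f\in X$ if and only if $f_1\in X$; (iii) if $f\in X$ then $z\mapsto f(\beta' z)$ belongs to $X$ for all $\beta'\in\mathbb{T}$. Let $m\in\mathrm{Hol}(\mathbb{D})$ with $mf\in X$ for all $f\in X$, let $\beta\in\mathbb{C}$ with $|\beta|=1$ and $\beta^n\neq1$ for all $n\in\mathbb{N}$, and let $T_X\in\mathcal{L}(X)$ be defined by $(T_Xf)(z)=m(z)f(\beta z)$. Assume there exists $z_0\in\mathbb{D}$ with $m(z_0)=0$. Then $\sigma(T_X)=\{\lambda\in\mathbb{C}:|\lambda|\leq r_\sigma(T_X)\}$.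
   Context: $\mathbb{D}$ is the open unit disc, $\mathbb{T}=\{\lambda\in\mathbb{C}:|\lambda|=1\}$, $\mathrm{Hol}(\mathbb{D})$ is the Fréchet space of holomorphic functions on $\mathbb{D}$ with the topology of uniform convergence on compact subsets, $e_k(z)=z^k$. $\sigma(T_X)$ is the spectrum of the bounded operator $T_X$ on the Banach space $X$ and $r_\sigma(T_X)$ its spectral radius. *)

theory Defs
  imports "HOL-Complex_Analysis.Complex_Analysis"
begin

definition discD :: "complex set" where
  "discD = ball 0 1"

text \<open>Elements of Hol(D) are represented by functions holomorphic on the disc
  and normalised to be 0 outside the disc (so that equality of functions is
  equality on the disc).\<close>
definition holD :: "(complex \<Rightarrow> complex) set" where
  "holD = {f. f holomorphic_on discD \<and> (\<forall>z. z \<notin> discD \<longrightarrow> f z = 0)}"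

definition onD :: "(complex \<Rightarrow> complex) \<Rightarrow> (complex \<Rightarrow> complex)" where
  "onD f = (\<lambda>z. if z \<in> discD then f z else 0)"

text \<open>X (with norm N) is a complex Banach space which is a linear subspace of
  Hol(D), with continuous inclusion into Hol(D) (topology of locally uniform
  convergence): on every compact subset of D, point evaluations are uniformly
  bounded by a multiple of the norm.\<close>
definition banach_subspace_holD ::
  "(complex \<Rightarrow> complex) set \<Rightarrow> ((complex \<Rightarrow> complex) \<Rightarrow> real) \<Rightarrow> bool" where
  "banach_subspace_holD X N \<longleftrightarrow>
     X \<subseteq> holD \<and>
     (\<lambda>z. 0) \<in> X \<and>
     (\<forall>f\<in>X. \<forall>g\<in>X. (\<lambda>z. f z + g z) \<in> X) \<and>
     (\<forall>c. \<forall>f\<in>X. (\<lambda>z. c * f z) \<in> X) \<and>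
     (\<forall>f\<in>X. N f \<ge> 0 \<and> (N f = 0 \<longleftrightarrow> f = (\<lambda>z. 0))) \<and>
     (\<forall>c. \<forall>f\<in>X. N (\<lambda>z. c * f z) = norm c * N f) \<and>
     (\<forall>f\<in>X. \<forall>g\<in>X. N (\<lambda>z. f z + g z) \<le> N f + N g) \<and>
     (\<forall>s. (\<forall>n. s n \<in> X) \<longrightarrow>
          (\<forall>e>0. \<exists>M. \<forall>m\<ge>M. \<forall>n\<ge>M. N (\<lambda>z. s m z - s n z) < e) \<longrightarrow>
          (\<exists>f\<in>X. (\<lambda>n. N (\<lambda>z. s n z - f z)) \<longlonglongrightarrow> 0)) \<and>
     (\<forall>K. compact K \<and> K \<subseteq> discD \<longrightarrow>
          (\<exists>C. \<forall>f\<in>X. \<forall>z\<in>K. norm (f z) \<le> C * N f))"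

definition bounded_op_on ::
  "(complex \<Rightarrow> complex) set \<Rightarrow> ((complex \<Rightarrow> complex) \<Rightarrow> real)
     \<Rightarrow> ((complex \<Rightarrow> complex) \<Rightarrow> (complex \<Rightarrow> complex)) \<Rightarrow> bool" where
  "bounded_op_on X N S \<longleftrightarrow>
     (\<forall>f\<in>X. S f \<in> X) \<and>
     (\<forall>f\<in>X. \<forall>g\<in>X. S (\<lambda>z. f z + g z) = (\<lambda>z. S f z + S g z)) \<and>
     (\<forall>c. \<forall>f\<in>X. S (\<lambda>z. c * f z) = (\<lambda>z. c * S f z)) \<and>
     (\<exists>C. \<forall>f\<in>X. N (S f) \<le> C * N f)"

definition op_spectrum ::
  "(complex \<Rightarrow> complex) set \<Rightarrow> ((complex \<Rightarrow> complex) \<Rightarrow> real)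
     \<Rightarrow> ((complex \<Rightarrow> complex) \<Rightarrow> (complex \<Rightarrow> complex)) \<Rightarrow> complex set" where
  "op_spectrum X N T = {l. \<not> (\<exists>S. bounded_op_on X N S \<and>
       (\<forall>f\<in>X. S (\<lambda>z. l * f z - T f z) = f) \<and>
       (\<forall>f\<in>X. (\<lambda>z. l * S f z - T (S f) z) = f))}"

definition op_spectral_radius ::
  "(complex \<Rightarrow> complex) set \<Rightarrow> ((complex \<Rightarrow> complex) \<Rightarrow> real)
     \<Rightarrow> ((complex \<Rightarrow> complex) \<Rightarrow> (complex \<Rightarrow> complex)) \<Rightarrow> real" where
  "op_spectral_radius X N T = Sup (norm ` op_spectrum X N T)"

end

theory Submission
  imports Defs "HOL-Library.Function_Algebras"
begin

text \<open>Multiplication by \<open>z\<close> intertwines \<open>T\<close> and \<open>\<beta> T\<close>, so the spectrum is invariant under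
  multiplication by \<open>\<beta>\<close>; being closed, it is invariant under all rotations because the powers of
  \<open>\<beta>\<close> are dense in the circle. It contains \<open>0\<close>, since every function in the range of \<open>T\<close> vanishes
  at \<open>z\<^sub>0\<close>, and it contains \<open>m(0)\<close>.

  Suppose that a circle \<open>\<bar>\<zeta>\<bar> = \<rho>\<close> with \<open>\<rho> > 0\<close> lies in the resolvent set. The \<open>n\<close>-th Taylor coefficient
  at \<open>0\<close> of \<open>(\<zeta> - T)\<inverse> f\<close> is a rational function of \<open>\<zeta>\<close> with poles of modulus \<open>\<bar>m(0)\<bar>\<close> only, so the
  Riesz projection of the circle is the identity if \<open>\<bar>m(0)\<bar> < \<rho>\<close> and zero if \<open>\<bar>m(0)\<bar> > \<rho>\<close>. In the first
  case there is no spectrum outside the circle; in the second case \<open>T\<close> is onto, which is impossible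
  as \<open>m(z\<^sub>0) = 0\<close>. Hence no circle of radius at most the spectral radius avoids the spectrum.\<close>

section \<open>Operators on a Banach space given by a carrier set\<close>

lemma LIMSEQ_0_le:
  fixes f g :: "nat \<Rightarrow> real"
  assumes "\<And>n. 0 \<le> f n" "\<And>n. f n \<le> g n" "g \<longlonglongrightarrow> 0"
  shows "f \<longlonglongrightarrow> 0"
  by (rule tendsto_sandwich[of "\<lambda>_. 0" f sequentially g]) (use assms in auto)

text \<open>The norm \<open>N\<close> is meaningful only on the set \<open>X\<close> of functions,
  so the Banach space theory is set up for a subspace of an ambient vector space instead of for a
  type.\<close>

locale carrier_banach = vector_space scale
  for scale :: "complex \<Rightarrow> 'v::ab_group_add \<Rightarrow> 'v" (infixr \<open>\<odot>\<close> 75) +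
  fixes X :: "'v set" and N :: "'v \<Rightarrow> real"
  assumes subspace_X: "subspace X"
    and N_nonneg: "x \<in> X \<Longrightarrow> 0 \<le> N x"
    and N_eq_0_iff: "x \<in> X \<Longrightarrow> N x = 0 \<longleftrightarrow> x = 0"
    and N_scale: "x \<in> X \<Longrightarrow> N (c \<odot> x) = norm c * N x"
    and N_triangle: "x \<in> X \<Longrightarrow> y \<in> X \<Longrightarrow> N (x + y) \<le> N x + N y"
    and N_complete: "(\<And>n. s n \<in> X) \<Longrightarrow> (\<And>e. e > 0 \<Longrightarrow> \<exists>M. \<forall>m\<ge>M. \<forall>n\<ge>M. N (s m - s n) < e)
                       \<Longrightarrow> \<exists>x\<in>X. (\<lambda>n. N (s n - x)) \<longlonglongrightarrow> 0"
begin

section \<open>Norm estimates and limits in the carrier\<close>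

lemmas X_closed [simp] = subspace_0[OF subspace_X] subspace_add[OF subspace_X]
  subspace_diff[OF subspace_X] subspace_neg[OF subspace_X] subspace_scale[OF subspace_X]
  subspace_sum[OF subspace_X]

lemma N_zero: "N 0 = 0"
  using N_eq_0_iff X_closed(1) by blast

lemma N_minus: "x \<in> X \<Longrightarrow> N (- x) = N x"
  using N_scale[of x "-1"] by simp

lemma N_commute: "x \<in> X \<Longrightarrow> y \<in> X \<Longrightarrow> N (x - y) = N (y - x)"
  using N_minus[of "x - y"] by simp

lemma N_diff_le: "x \<in> X \<Longrightarrow> y \<in> X \<Longrightarrow> N (x - y) \<le> N x + N y"
  using N_triangle[of x "- y"] N_minus subspace_neg[OF subspace_X] by simp

lemma N_triangle3: "x \<in> X \<Longrightarrow> y \<in> X \<Longrightarrow> z \<in> X \<Longrightarrow> N (x - z) \<le> N (x - y) + N (y - z)"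
  using N_triangle[of "x - y" "y - z"] by simp

lemma N_sum_le: "(\<And>i. i \<in> I \<Longrightarrow> f i \<in> X) \<Longrightarrow> N (sum f I) \<le> (\<Sum>i\<in>I. N (f i))"
proof (induction I rule: infinite_finite_induct)
  case (insert i I)
  then have "N (f i + sum f I) \<le> N (f i) + N (sum f I)"
    by (intro N_triangle X_closed) auto
  with insert show ?case by fastforce
qed (auto simp: N_zero)

lemma N_lim_unique:
  assumes "\<And>n. s n \<in> X" "x \<in> X" "y \<in> X"
    and "(\<lambda>n. N (s n - x)) \<longlonglongrightarrow> 0" "(\<lambda>n. N (s n - y)) \<longlonglongrightarrow> 0"
  shows "x = y"
proof -
  have "(\<lambda>n. N (s n - x) + N (s n - y)) \<longlonglongrightarrow> 0 + 0"
    using assms by (intro tendsto_add)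
  moreover have "N (x - y) \<le> N (s n - x) + N (s n - y)" for n
    using N_triangle3[of x "s n" y] N_commute[of x "s n"] assms by simp
  ultimately have "N (x - y) \<le> 0"
    using LIMSEQ_le_const[of _ "0 + 0" "N (x - y)"] by auto
  then show ?thesis
    using N_eq_0_iff[of "x - y"] N_nonneg[of "x - y"] assms by fastforce
qed

lemma N_lim_bound:
  assumes "\<And>n. s n \<in> X" "x \<in> X" "(\<lambda>n. N (s n - x)) \<longlonglongrightarrow> 0" "\<And>n. N (s n) \<le> B"
  shows "N x \<le> B"
proof -
  have "(\<lambda>n. N (s n - x) + B) \<longlonglongrightarrow> 0 + B"
    using assms by (intro tendsto_add tendsto_const)
  moreover have "N x \<le> N (s n - x) + B" for n
    using N_triangle3[of x "s n" 0] N_commute[of x "s n"] assms(1,2) assms(4)[of n] by fastforce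
  ultimately show ?thesis
    using LIMSEQ_le_const[of _ "0 + B" "N x"] by auto
qed

lemma geometric_convergent:
  assumes s: "\<And>n. s n \<in> X" and step: "\<And>n. N (s (Suc n) - s n) \<le> K * (1/2) ^ n"
  shows "\<exists>x\<in>X. (\<lambda>n. N (s n - x)) \<longlonglongrightarrow> 0"
proof (rule N_complete[OF s])
  have K: "0 \<le> K" using step[of 0] N_nonneg[of "s 1 - s 0"] s by fastforce
  \<comment> \<open>Keeping the subtracted term of the geometric sum makes the induction on
    \<open>k\<close> close with equality; it is dropped only afterwards.\<close>
  have ub: "N (s (n + k) - s n) \<le> 2 * K * ((1/2) ^ n - (1/2) ^ (n + k))" for n k
  proof (induction k)
    case (Suc k)
    have "N (s (n + Suc k) - s n) \<le> N (s (Suc (n + k)) - s (n + k)) + N (s (n + k) - s n)"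
      using N_triangle3 s by simp
    also have "\<dots> \<le> K * (1/2) ^ (n + k) + 2 * K * ((1/2) ^ n - (1/2) ^ (n + k))"
      using step Suc by (intro add_mono)
    also have "\<dots> = 2 * K * ((1/2) ^ n - (1/2) ^ (n + Suc k))"
      by (simp add: algebra_simps)
    finally show ?case .
  qed (simp add: N_zero)
  have ub': "N (s m - s n) \<le> 2 * K * (1/2) ^ n" if "n \<le> m" for m n
  proof -
    have "N (s m - s n) \<le> 2 * K * ((1/2) ^ n - (1/2) ^ m)"
      using ub[of n "m - n"] that by simp
    also have "\<dots> \<le> 2 * K * (1/2) ^ n" using K by (intro mult_left_mono) auto
    finally show ?thesis .
  qed
  fix e :: real assume "e > 0"
  have "(\<lambda>n. 2 * K * (1/2) ^ n) \<longlonglongrightarrow> 2 * K * 0"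
    by (intro tendsto_intros LIMSEQ_power_zero) auto
  then have "eventually (\<lambda>n. 2 * K * (1/2) ^ n < e) sequentially"
    using \<open>e > 0\<close> by (intro order_tendstoD(2)) auto
  then obtain M where M: "\<And>n. n \<ge> M \<Longrightarrow> 2 * K * (1/2) ^ n < e"
    by (auto simp: eventually_sequentially)
  have "N (s m - s n) < e" if "m \<ge> M" "n \<ge> M" for m n
  proof (cases "n \<le> m")
    case True
    with ub' M[OF that(2)] show ?thesis by fastforce
  next
    case False
    then have "N (s n - s m) < e" using ub'[of m n] M[OF that(1)] by fastforce
    then show ?thesis using N_commute s by simp
  qed
  then show "\<exists>M. \<forall>m\<ge>M. \<forall>n\<ge>M. N (s m - s n) < e" by blast
qed

section \<open>Bounded operators, successive approximation and perturbation\<close>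

definition bounded_op :: "('v \<Rightarrow> 'v) \<Rightarrow> bool" where
  "bounded_op A \<longleftrightarrow> (\<forall>x\<in>X. A x \<in> X) \<and> (\<forall>x\<in>X. \<forall>y\<in>X. A (x + y) = A x + A y)
     \<and> (\<forall>c. \<forall>x\<in>X. A (c \<odot> x) = c \<odot> A x) \<and> (\<exists>K. \<forall>x\<in>X. N (A x) \<le> K * N x)"

lemma bounded_op_in: "bounded_op A \<Longrightarrow> x \<in> X \<Longrightarrow> A x \<in> X"
  and bounded_op_add: "bounded_op A \<Longrightarrow> x \<in> X \<Longrightarrow> y \<in> X \<Longrightarrow> A (x + y) = A x + A y"
  and bounded_op_scale: "bounded_op A \<Longrightarrow> x \<in> X \<Longrightarrow> A (c \<odot> x) = c \<odot> A x"
  unfolding bounded_op_def by blast+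

lemma bounded_op_zero: "bounded_op A \<Longrightarrow> A 0 = 0"
  using bounded_op_scale[of A 0 0] by simp

lemma bounded_op_diff: "bounded_op A \<Longrightarrow> x \<in> X \<Longrightarrow> y \<in> X \<Longrightarrow> A (x - y) = A x - A y"
  using bounded_op_add[of A x "- y"] bounded_op_scale[of A y "-1"] by simp

lemma bounded_op_sum: "bounded_op A \<Longrightarrow> (\<And>i. i \<in> I \<Longrightarrow> f i \<in> X) \<Longrightarrow> A (sum f I) = (\<Sum>i\<in>I. A (f i))"
proof (induction I rule: infinite_finite_induct)
  case (insert i I)
  then show ?case
    using bounded_op_add[of A "f i" "sum f I"] by simp
qed (auto simp: bounded_op_zero)

lemma bounded_op_bound:
  assumes "bounded_op A"
  obtains K where "K > 0" "\<And>x. x \<in> X \<Longrightarrow> N (A x) \<le> K * N x"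
proof -
  obtain K where K: "\<And>x. x \<in> X \<Longrightarrow> N (A x) \<le> K * N x"
    using assms unfolding bounded_op_def by blast
  have "N (A x) \<le> (\<bar>K\<bar> + 1) * N x" if "x \<in> X" for x
  proof -
    have "K * N x \<le> (\<bar>K\<bar> + 1) * N x" using N_nonneg[OF that] by (intro mult_right_mono) auto
    then show ?thesis using K[OF that] by linarith
  qed
  then show thesis by (intro that[of "\<bar>K\<bar> + 1"]) auto
qed

lemma bounded_op_tendsto:
  assumes A: "bounded_op A" and s: "\<And>n. s n \<in> X" "x \<in> X" and lim: "(\<lambda>n. N (s n - x)) \<longlonglongrightarrow> 0"
  shows "(\<lambda>n. N (A (s n) - A x)) \<longlonglongrightarrow> 0"
proof -
  obtain K where K: "K > 0" "\<And>x. x \<in> X \<Longrightarrow> N (A x) \<le> K * N x"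
    using bounded_op_bound A by blast
  show ?thesis
  proof (rule LIMSEQ_0_le)
    show "(\<lambda>n. K * N (s n - x)) \<longlonglongrightarrow> 0"
      using tendsto_mult_left[OF lim, of K] by simp
    show "N (A (s n) - A x) \<le> K * N (s n - x)" for n
      using K(2)[of "s n - x"] bounded_op_diff[OF A] s by simp
    show "0 \<le> N (A (s n) - A x)" for n
      using N_nonneg s bounded_op_in[OF A] by simp
  qed
qed

text \<open>Successive approximation: solving for the remaining error halves it each time, so the
  corrections form a geometric series whose sum is an exact solution. It serves both as a Neumann
  series argument and as the last step of the open mapping argument.\<close>

lemma approx_surj_imp_surj:
  assumes B: "bounded_op B"
    and approx: "\<And>y. y \<in> X \<Longrightarrow> \<exists>x\<in>X. N x \<le> K * N y \<and> N (y - B x) \<le> N y / 2"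
    and y: "y \<in> X"
  shows "\<exists>x\<in>X. B x = y \<and> N x \<le> 2 * K * N y"
proof -
  obtain g where g: "\<And>y. y \<in> X \<Longrightarrow> g y \<in> X" "\<And>y. y \<in> X \<Longrightarrow> N (g y) \<le> K * N y"
    "\<And>y. y \<in> X \<Longrightarrow> N (y - B (g y)) \<le> N y / 2"
    using approx by metis
  \<comment> \<open>\<open>r k\<close> is the error left after \<open>k\<close> corrections and
    \<open>s k\<close> the sum of these corrections, so \<open>B (s k) = y - r k\<close>.\<close>
  define r where "r k = ((\<lambda>z. z - B (g z)) ^^ k) y" for k
  define s where "s k = (\<Sum>i<k. g (r i))" for k
  have r_Suc: "r (Suc k) = r k - B (g (r k))" for k by (simp add: r_def)
  have rX: "r k \<in> X" for k
    by (induction k) (auto simp: r_Suc y g bounded_op_in[OF B], simp add: r_def y)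
  have rN: "N (r k) \<le> N y * (1/2) ^ k" for k
  proof (induction k)
    case (Suc k)
    then show ?case using g(3)[OF rX, of k] by (simp add: r_Suc)
  qed (simp add: r_def)
  have sX: "s k \<in> X" for k by (auto simp: s_def intro!: X_closed g rX)
  have Bs: "B (s k) = y - r k" for k
  proof (induction k)
    case (Suc k)
    have "B (s (Suc k)) = B (s k) + B (g (r k))"
      using bounded_op_add[OF B sX g(1)[OF rX]] by (simp add: s_def)
    with Suc show ?case by (simp add: r_Suc)
  qed (simp add: s_def r_def bounded_op_zero[OF B])
  have gN: "N (g (r k)) \<le> K * N y * (1/2) ^ k" if "K \<ge> 0" for k
    using g(2)[OF rX, of k] mult_left_mono[OF rN[of k] that] by (simp add: mult.assoc)
  show ?thesis
  \<comment> \<open>The sign of \<open>K\<close> is read off from the approximation of a nonzero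
    \<open>y\<close>, hence the separate case.\<close>
  proof (cases "y = 0")
    case True
    then show ?thesis using bounded_op_zero[OF B] by (auto simp: N_zero)
  next
    case False
    then have "N y > 0" using N_eq_0_iff[OF y] N_nonneg[OF y] by linarith
    then have K: "K \<ge> 0"
      using g(2)[OF y] N_nonneg[OF g(1)[OF y]] by (meson mult_neg_pos not_less order_trans)
    obtain x where x: "x \<in> X" "(\<lambda>n. N (s n - x)) \<longlonglongrightarrow> 0"
      using geometric_convergent[of s "K * N y"] sX gN[OF K] by (auto simp: s_def)
    have "(\<lambda>n. N (B (s n) - y)) \<longlonglongrightarrow> 0"
    proof (rule LIMSEQ_0_le)
      have "(\<lambda>k. N y * (1/2) ^ k) \<longlonglongrightarrow> N y * 0"
        by (intro tendsto_intros LIMSEQ_power_zero) auto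
      then show "(\<lambda>k. N y * (1/2) ^ k) \<longlonglongrightarrow> 0" by simp
      show "N (B (s n) - y) \<le> N y * (1/2) ^ n" for n
        using rN N_minus rX by (simp add: Bs)
      show "0 \<le> N (B (s n) - y)" for n
        using N_nonneg y bounded_op_in[OF B sX] by simp
    qed
    then have "B x = y"
      using N_lim_unique[of "\<lambda>n. B (s n)" "B x" y] bounded_op_tendsto[OF B sX x]
        bounded_op_in[OF B] sX x y by blast
    moreover have "N x \<le> 2 * K * N y"
    proof (rule N_lim_bound[OF sX x])
      fix n
      have "N (s n) \<le> (\<Sum>i<n. N (g (r i)))"
        unfolding s_def using g rX by (intro N_sum_le) auto
      also have "\<dots> \<le> (\<Sum>i<n. K * N y * (1/2) ^ i)" using gN[OF K] by (intro sum_mono)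
      also have "\<dots> = K * N y * (\<Sum>i<n. (1/2) ^ i)" by (simp add: sum_distrib_left)
      also have "\<dots> \<le> K * N y * 2"
        using K \<open>N y > 0\<close> by (intro mult_left_mono) (auto simp: geometric_sum)
      finally show "N (s n) \<le> 2 * K * N y" by (simp add: mult_ac)
    qed
    ultimately show ?thesis using x by blast
  qed
qed

text \<open>An exact solution for \<open>A\<close> is an approximate solution for \<open>B\<close>
  with error at most \<open>C * e \<le> 1/2\<close> times the size of the data, so surjectivity
  follows by successive approximation. The lower bound survives with \<open>C\<close> doubled,
  because the error term can be absorbed, and it gives injectivity.\<close>

lemma perturbation:
  assumes A: "bij_betw A X X" and C: "C \<ge> 0" "\<And>x. x \<in> X \<Longrightarrow> N x \<le> C * N (A x)"
    and B: "bounded_op B" and AB: "\<And>x. x \<in> X \<Longrightarrow> N (A x - B x) \<le> e * N x"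
    and small: "e \<ge> 0" "C * e \<le> 1/2"
  shows "bij_betw B X X" and "x \<in> X \<Longrightarrow> N x \<le> 2 * C * N (B x)"
proof -
  have AX: "A x \<in> X" if "x \<in> X" for x using A that by (auto simp: bij_betw_def)
  show lower: "N x \<le> 2 * C * N (B x)" if x: "x \<in> X" for x
  proof -
    have "N (A x) \<le> N (A x - B x) + N (B x)"
      using N_triangle3[of "A x" "B x" 0] AX x bounded_op_in[OF B] by simp
    also have "\<dots> \<le> e * N x + N (B x)" using AB x by simp
    finally have "C * N (A x) \<le> (C * e) * N x + C * N (B x)"
      using C(1) mult_left_mono by (fastforce simp: algebra_simps)
    also have "(C * e) * N x \<le> 1/2 * N x" using small N_nonneg[OF x] by (intro mult_right_mono)
    finally show ?thesis using C(2)[OF x] by simp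
  qed
  have "\<exists>x\<in>X. B x = y \<and> N x \<le> 2 * C * N y" if y: "y \<in> X" for y
  proof (rule approx_surj_imp_surj[OF B _ y])
    fix y assume y: "y \<in> X"
    then have "y \<in> A ` X" by (simp add: bij_betw_imp_surj_on[OF A])
    then obtain x where x: "x \<in> X" "A x = y" by (elim imageE) simp
    have "N (y - B x) \<le> e * N x" using AB x by blast
    also have "\<dots> \<le> e * (C * N y)" using C(2)[of x] x small by (intro mult_left_mono) auto
    also have "\<dots> = (C * e) * N y" by simp
    also have "\<dots> \<le> 1/2 * N y" using small N_nonneg[OF y] by (intro mult_right_mono)
    finally show "\<exists>x\<in>X. N x \<le> C * N y \<and> N (y - B x) \<le> N y / 2"
      using C(2)[of x] x by auto
  qed
  then have "B ` X = X" using bounded_op_in[OF B] by (intro equalityI subsetI) (auto simp: image_iff)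
  moreover have "inj_on B X"
  proof (rule inj_onI)
    fix x y assume xy: "x \<in> X" "y \<in> X" "B x = B y"
    then have "N (x - y) \<le> 0"
      using lower[of "x - y"] bounded_op_diff[OF B] N_zero by simp
    then show "x = y"
      using N_eq_0_iff[of "x - y"] N_nonneg[of "x - y"] xy by fastforce
  qed
  ultimately show "bij_betw B X X" by (simp add: bij_betw_def)
qed

section \<open>Baire category and the bounded inverse theorem\<close>

definition dX :: "'v \<Rightarrow> 'v \<Rightarrow> real" where
  "dX x y = (if x \<in> X \<and> y \<in> X then N (x - y) else 0)"

text \<open>This makes Baire's theorem for complete metric spaces available. \<open>dX\<close> is
  set to 0 off \<open>X\<close> because non-negativity and symmetry are required on the whole type,
  where \<open>N\<close> is unconstrained.\<close>

interpretation MX: Metric_space X dX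
proof
  fix x y z
  show "0 \<le> dX x y" by (auto simp: dX_def intro: N_nonneg X_closed)
  show "dX x y = dX y x" by (auto simp: dX_def N_commute)
  show "dX x y = 0 \<longleftrightarrow> x = y" if "x \<in> X" "y \<in> X"
    using that N_eq_0_iff[of "x - y"] by (simp add: dX_def)
  show "dX x z \<le> dX x y + dX y z" if "x \<in> X" "y \<in> X" "z \<in> X"
    using that N_triangle3 by (simp add: dX_def)
qed

lemma mcomplete_X: "MX.mcomplete"
  unfolding MX.mcomplete_def
proof (intro allI impI)
  fix s assume s: "MX.MCauchy s"
  then have sX: "s n \<in> X" for n by (auto simp: MX.MCauchy_def)
  have "\<exists>x\<in>X. (\<lambda>n. N (s n - x)) \<longlonglongrightarrow> 0"
  proof (rule N_complete[OF sX])
    fix e :: real assume "e > 0"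
    then show "\<exists>M. \<forall>m\<ge>M. \<forall>n\<ge>M. N (s m - s n) < e"
      using s sX by (auto simp: MX.MCauchy_def dX_def)
  qed
  then obtain x where x: "x \<in> X" "(\<lambda>n. N (s n - x)) \<longlonglongrightarrow> 0" by blast
  then have "limitin MX.mtopology s x sequentially"
    using sX by (auto simp: MX.limitin_metric dX_def dest!: order_tendstoD(2))
  then show "\<exists>x. limitin MX.mtopology s x sequentially" by blast
qed

text \<open>The open mapping argument: by Baire's theorem the closure of the image of some ball has
  interior, so small vectors are approximable by images of a bounded set. Rescaling and successive
  approximation then yield preimages of controlled norm.\<close>

theorem bounded_inverse:
  assumes A: "bounded_op A" and bij: "bij_betw A X X"
  obtains C where "C > 0" "\<And>x. x \<in> X \<Longrightarrow> N x \<le> C * N (A x)"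
proof -
  define I where "I n = MX.mtopology closure_of (A ` {x \<in> X. N x \<le> real n})" for n :: nat
  have AX: "A ` X = X" using bij by (simp add: bij_betw_def)
  have Isub: "I n \<subseteq> X" for n unfolding I_def by (auto simp: MX.metric_closure_of)
  have UN: "\<Union> (range I) = X"
  proof (intro equalityI subsetI)
    fix y assume "y \<in> X"
    then obtain x where x: "x \<in> X" "y = A x" using AX by blast
    obtain n :: nat where "N x \<le> real n" using real_arch_simple by blast
    then have "y \<in> A ` {x \<in> X. N x \<le> real n}" using x by blast
    moreover have "A ` {x \<in> X. N x \<le> real n} \<subseteq> I n"
      unfolding I_def by (rule closure_of_subset) (use AX in auto)
    ultimately show "y \<in> \<Union> (range I)" by blast
  qed (use Isub in blast)
  have "\<exists>n. MX.mtopology interior_of (I n) \<noteq> {}"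
  proof (rule ccontr)
    assume "\<not> ?thesis"
    then have "MX.mtopology interior_of \<Union> (range I) = {}"
      by (intro MX.metric_Baire_category_alt mcomplete_X) (auto simp: I_def)
    then have "X = {}" unfolding UN by (metis MX.open_in_mspace interior_of_openin)
    then show False using X_closed(1) by blast
  qed
  then obtain n x0 \<delta> where x0: "x0 \<in> X" and \<delta>: "\<delta> > 0" "MX.mball x0 \<delta> \<subseteq> I n"
    by (auto simp: MX.metric_interior_of)
  have close: "\<exists>x\<in>X. N x \<le> real n \<and> N (x0 + y - A x) < e" if y: "y \<in> X" "N y < \<delta>" "e > 0" for y e
  proof -
    have "x0 + y \<in> MX.mball x0 \<delta>" using y x0 by (simp add: dX_def N_minus)
    then have "x0 + y \<in> I n" using \<delta> by blast
    then obtain z where "z \<in> A ` {x \<in> X. N x \<le> real n}" "z \<in> MX.mball (x0 + y) e"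
      unfolding I_def MX.metric_closure_of using y(3) by blast
    then show ?thesis by (auto simp: dX_def)
  qed
  \<comment> \<open>The difference of an approximant of \<open>x0 + y\<close> and one of
    \<open>x0\<close> approximates \<open>y\<close>; moving the centre to 0 costs a factor 2 in the
    radius.\<close>
  have approx0: "\<exists>x\<in>X. N x \<le> 2 * real n \<and> N (y - A x) < e" if y: "y \<in> X" "N y < \<delta>" "e > 0" for y e
  proof -
    obtain x1 where x1: "x1 \<in> X" "N x1 \<le> real n" "N (x0 + y - A x1) < e / 2"
      using close[of y "e/2"] y by auto
    obtain x2 where x2: "x2 \<in> X" "N x2 \<le> real n" "N (x0 + 0 - A x2) < e / 2"
      using close[of 0 "e/2"] y \<delta> N_zero by auto
    have "N (y - A (x1 - x2)) = N ((x0 + y - A x1) - (x0 + 0 - A x2))"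
      by (simp add: bounded_op_diff[OF A x1(1) x2(1)] algebra_simps)
    also have "\<dots> \<le> N (x0 + y - A x1) + N (x0 + 0 - A x2)"
      using bounded_op_in[OF A x1(1)] bounded_op_in[OF A x2(1)] x0 y(1) by (intro N_diff_le) simp_all
    also have "\<dots> < e" using x1 x2 by simp
    finally show ?thesis
      using N_diff_le[of x1 x2] x1 x2 by (intro bexI[of _ "x1 - x2"]) auto
  qed
  \<comment> \<open>Scaling \<open>y\<close> by \<open>c = \<delta> / (2 * N y)\<close> brings it to
    norm \<open>\<delta> / 2\<close>; undoing this turns the bound \<open>2 * n\<close> into
    \<open>2 * n / c = (4 * n / \<delta>) * N y\<close>.\<close>
  define K where "K = 4 * real n / \<delta>"
  have approx: "\<exists>x\<in>X. N x \<le> K * N y \<and> N (y - A x) \<le> N y / 2" if y: "y \<in> X" for y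
  proof (cases "y = 0")
    case True
    then show ?thesis using bounded_op_zero[OF A] by (intro bexI[of _ 0]) (auto simp: N_zero)
  next
    case False
    then have Ny: "N y > 0" using N_eq_0_iff[OF y] N_nonneg[OF y] by linarith
    define c :: real where "c = \<delta> / (2 * N y)"
    have c: "c > 0" using \<delta> Ny by (simp add: c_def)
    have Ncy: "N (complex_of_real c \<odot> y) = c * N y" using N_scale[OF y, of c] c by simp
    also have "\<dots> = \<delta> / 2" using Ny by (simp add: c_def)
    also have "\<dots> < \<delta>" using \<delta> by simp
    finally have "N (complex_of_real c \<odot> y) < \<delta>" .
    then obtain x where x: "x \<in> X" "N x \<le> 2 * real n" "N (complex_of_real c \<odot> y - A x) < c * N y / 2"
      using approx0[OF X_closed(5)[OF y], of "complex_of_real c" "c * N y / 2"] c Ny by force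
    define x' where "x' = complex_of_real (1/c) \<odot> x"
    have x': "x' \<in> X" using x by (simp add: x'_def)
    have "N x' = N x / c"
      unfolding x'_def N_scale[OF x(1)] using c by (simp add: norm_divide)
    also have "\<dots> \<le> 2 * real n / c" using x c by (simp add: divide_right_mono)
    also have "\<dots> = K * N y" using \<delta> by (simp add: K_def c_def field_simps)
    finally have 1: "N x' \<le> K * N y" .
    have "y - A x' = complex_of_real (1/c) \<odot> (complex_of_real c \<odot> y - A x)"
      using c bounded_op_scale[OF A x(1)] by (simp add: x'_def scale_right_diff_distrib)
    then have "N (y - A x') = N (complex_of_real c \<odot> y - A x) / c"
      using N_scale[of "complex_of_real c \<odot> y - A x" "complex_of_real (1/c)"] c y
        bounded_op_in[OF A x(1)] by (simp add: norm_divide)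
    also have "\<dots> \<le> (c * N y / 2) / c" using x(3) c by (intro divide_right_mono) auto
    also have "\<dots> = N y / 2" using c by simp
    finally show ?thesis using 1 x' by blast
  qed
  have lower: "N x \<le> 2 * K * N (A x)" if x: "x \<in> X" for x
  proof -
    obtain x' where x': "x' \<in> X" "A x' = A x" "N x' \<le> 2 * K * N (A x)"
      using approx_surj_imp_surj[OF A approx bounded_op_in[OF A x]] by blast
    \<comment> \<open>Injectivity identifies the preimage of controlled norm with the given
      \<open>x\<close>, which turns solvability with a bound into a lower bound for
      \<open>A\<close>.\<close>
    moreover have "x' = x" using bij x x' by (auto simp: bij_betw_def dest: inj_onD)
    ultimately show ?thesis by simp
  qed
  have "K \<ge> 0" using \<delta> by (simp add: K_def)
  show thesis
  \<comment> \<open>The added 1 gives a positive constant even if \<open>n = 0\<close> and hence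
    \<open>K = 0\<close>.\<close>
  proof (rule that[of "2 * K + 1"])
    show "N x \<le> (2 * K + 1) * N (A x)" if "x \<in> X" for x
      using lower[OF that] N_nonneg[OF bounded_op_in[OF A that]] by (simp add: distrib_right)
  qed (use \<open>K \<ge> 0\<close> in simp)
qed

section \<open>Resolvent set, resolvent and norm-convergent Riemann sums\<close>

definition shift :: "('v \<Rightarrow> 'v) \<Rightarrow> complex \<Rightarrow> 'v \<Rightarrow> 'v" where
  "shift T \<zeta> x = \<zeta> \<odot> x - T x"

text \<open>Plain bijectivity suffices as the notion of a resolvent point: for bounded
  \<open>T\<close>, \<open>bounded_inverse\<close> supplies continuity of the inverse.\<close>

definition regular :: "('v \<Rightarrow> 'v) \<Rightarrow> complex \<Rightarrow> bool" where
  "regular T \<zeta> \<longleftrightarrow> bij_betw (shift T \<zeta>) X X"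

definition resolvent :: "('v \<Rightarrow> 'v) \<Rightarrow> complex \<Rightarrow> 'v \<Rightarrow> 'v" where
  "resolvent T \<zeta> = inv_into X (shift T \<zeta>)"

lemma bounded_op_shift:
  assumes T: "bounded_op T"
  shows "bounded_op (shift T \<zeta>)"
proof -
  obtain K where K: "K > 0" "\<And>x. x \<in> X \<Longrightarrow> N (T x) \<le> K * N x"
    using bounded_op_bound T by blast
  have "\<exists>K. \<forall>x\<in>X. N (shift T \<zeta> x) \<le> K * N x"
  proof (intro exI ballI)
    show "N (shift T \<zeta> x) \<le> (cmod \<zeta> + K) * N x" if "x \<in> X" for x
      using N_diff_le[of "\<zeta> \<odot> x" "T x"] K(2)[OF that] that bounded_op_in[OF T that] N_scale
      by (simp add: shift_def distrib_right)
  qed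
  then show ?thesis
    unfolding bounded_op_def shift_def
    by (simp add: bounded_op_in[OF T] bounded_op_add[OF T] bounded_op_scale[OF T] algebra_simps)
qed

lemma shift_in: "bounded_op T \<Longrightarrow> x \<in> X \<Longrightarrow> shift T \<zeta> x \<in> X"
  using bounded_op_in bounded_op_shift by blast

lemma resolvent_in: "regular T \<zeta> \<Longrightarrow> y \<in> X \<Longrightarrow> resolvent T \<zeta> y \<in> X"
  unfolding resolvent_def regular_def by (metis bij_betw_imp_surj_on inv_into_into)

lemma shift_resolvent: "regular T \<zeta> \<Longrightarrow> y \<in> X \<Longrightarrow> shift T \<zeta> (resolvent T \<zeta> y) = y"
  unfolding resolvent_def regular_def by (metis bij_betw_imp_surj_on f_inv_into_f)

text \<open>Changing \<open>\<zeta>\<close> to \<open>\<mu>\<close> perturbs the operator by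
  \<open>\<bar>\<zeta> - \<mu>\<bar>\<close> in norm, so the radius is half the reciprocal of the
  lower-bound constant at \<open>\<zeta>\<close>. One constant then serves the whole ball, as the
  compactness argument on circles requires.\<close>

lemma regular_nbhd:
  assumes T: "bounded_op T" and reg: "regular T \<zeta>"
  obtains C \<delta> where "C > 0" "\<delta> > 0" "\<And>\<mu>. \<mu> \<in> ball \<zeta> \<delta> \<Longrightarrow> regular T \<mu>"
    "\<And>\<mu> x. \<mu> \<in> ball \<zeta> \<delta> \<Longrightarrow> x \<in> X \<Longrightarrow> N x \<le> C * N (shift T \<mu> x)"
proof -
  obtain C where C: "C > 0" "\<And>x. x \<in> X \<Longrightarrow> N x \<le> C * N (shift T \<zeta> x)"
    using bounded_inverse[OF bounded_op_shift[OF T]] reg unfolding regular_def by blast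
  have *: "bij_betw (shift T \<mu>) X X" "x \<in> X \<Longrightarrow> N x \<le> 2 * C * N (shift T \<mu> x)"
    if mu: "\<mu> \<in> ball \<zeta> (1 / (2 * C))" for \<mu> x
  proof -
    have e: "C * cmod (\<zeta> - \<mu>) \<le> 1 / 2" using mu C(1) by (simp add: dist_norm field_simps)
    have d: "N (shift T \<zeta> x - shift T \<mu> x) \<le> cmod (\<zeta> - \<mu>) * N x" if "x \<in> X" for x
      using N_scale[OF that, of "\<zeta> - \<mu>"] by (simp add: shift_def scale_left_diff_distrib)
    note pert = perturbation[of "shift T \<zeta>" C "shift T \<mu>" "cmod (\<zeta> - \<mu>)"]
    show "bij_betw (shift T \<mu>) X X"
      using pert(1) reg C d e bounded_op_shift[OF T] by (simp add: regular_def)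
    show "N x \<le> 2 * C * N (shift T \<mu> x)" if "x \<in> X"
      using pert(2) reg C d e bounded_op_shift[OF T] that by (simp add: regular_def)
  qed
  show thesis
    by (rule that[of "2 * C" "1 / (2 * C)"]) (use C * in \<open>auto simp: regular_def\<close>)
qed

lemma open_regular:
  assumes T: "bounded_op T" shows "open {\<zeta>. regular T \<zeta>}"
proof (rule openI)
  fix \<zeta> assume "\<zeta> \<in> {\<zeta>. regular T \<zeta>}"
  then have "regular T \<zeta>" by simp
  then show "\<exists>e>0. ball \<zeta> e \<subseteq> {\<zeta>. regular T \<zeta>}"
    by (rule regular_nbhd[OF T]) blast
qed

text \<open>For \<open>\<bar>\<zeta>\<bar> > 2 * K\<close> the operator is a small perturbation of
  multiplication by the scalar \<open>\<zeta>\<close>, whose inverse has norm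
  \<open>1 / \<bar>\<zeta>\<bar>\<close>.\<close>

lemma regular_large:
  assumes T: "bounded_op T"
  obtains R where "\<And>\<zeta>. cmod \<zeta> > R \<Longrightarrow> regular T \<zeta>"
proof -
  obtain K where K: "K > 0" "\<And>x. x \<in> X \<Longrightarrow> N (T x) \<le> K * N x"
    using bounded_op_bound T by blast
  have "regular T \<zeta>" if l: "cmod \<zeta> > 2 * K" for \<zeta>
  proof -
    have l0: "\<zeta> \<noteq> 0" using l K by auto
    have "bij_betw ((\<odot>) \<zeta>) X X"
      by (rule bij_betwI[where g = "(\<odot>) (inverse \<zeta>)"]) (use l0 in auto)
    moreover have "N (\<zeta> \<odot> x - shift T \<zeta> x) \<le> K * N x" if "x \<in> X" for x
      using K(2)[OF that] by (simp add: shift_def)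
    moreover have "1 / cmod \<zeta> * K \<le> 1 / 2" using l l0 by (simp add: field_simps)
    ultimately show ?thesis
      using perturbation(1)[of "(\<odot>) \<zeta>" "1 / cmod \<zeta>" "shift T \<zeta>" K] bounded_op_shift[OF T] l0 K
      by (simp add: regular_def N_scale)
  qed
  then show thesis by (rule that)
qed

lemma regular_compact_bound:
  assumes T: "bounded_op T" and S: "compact S" "\<And>\<zeta>. \<zeta> \<in> S \<Longrightarrow> regular T \<zeta>"
  obtains C where "C > 0" "\<And>\<zeta> x. \<zeta> \<in> S \<Longrightarrow> x \<in> X \<Longrightarrow> N x \<le> C * N (shift T \<zeta> x)"
proof -
  have "\<exists>C \<delta>. C > 0 \<and> \<delta> > 0 \<and> (\<forall>\<mu>\<in>ball \<zeta> \<delta>. \<forall>x\<in>X. N x \<le> C * N (shift T \<mu> x))" if "\<zeta> \<in> S" for \<zeta>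
    by (rule regular_nbhd[OF T S(2)[OF that]]) blast
  then obtain C \<delta> where C: "\<And>\<zeta>. \<zeta> \<in> S \<Longrightarrow> C \<zeta> > (0::real)" "\<And>\<zeta>. \<zeta> \<in> S \<Longrightarrow> \<delta> \<zeta> > 0"
    "\<And>\<zeta> \<mu> x. \<zeta> \<in> S \<Longrightarrow> \<mu> \<in> ball \<zeta> (\<delta> \<zeta>) \<Longrightarrow> x \<in> X \<Longrightarrow> N x \<le> C \<zeta> * N (shift T \<mu> x)"
    by metis
  have "S \<subseteq> (\<Union>\<zeta>\<in>S. ball \<zeta> (\<delta> \<zeta>))" using C(2) by auto
  then obtain F where F: "F \<subseteq> S" "finite F" "S \<subseteq> (\<Union>\<zeta>\<in>F. ball \<zeta> (\<delta> \<zeta>))"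
    using compactE_image[OF S(1), of S "\<lambda>\<zeta>. ball \<zeta> (\<delta> \<zeta>)"] by blast
  \<comment> \<open>The sum dominates each of the finitely many local constants; the summand 1 keeps
    \<open>B\<close> positive when \<open>F\<close> is empty.\<close>
  define B where "B = 1 + sum C F"
  have B: "C \<zeta> \<le> B" if "\<zeta> \<in> F" for \<zeta>
  proof -
    have "C \<zeta> \<le> sum C F"
      by (rule member_le_sum[OF that _ F(2)]) (use C(1) F(1) in \<open>auto intro: less_imp_le\<close>)
    then show ?thesis by (simp add: B_def)
  qed
  show thesis
  proof (rule that[of B])
    have "sum C F \<ge> 0" using C(1) F(1) by (intro sum_nonneg) (auto intro: less_imp_le)
    then show "B > 0" by (simp add: B_def)
    fix \<mu> x assume mx: "\<mu> \<in> S" "x \<in> X"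
    then obtain \<zeta> where \<zeta>: "\<zeta> \<in> F" "\<mu> \<in> ball \<zeta> (\<delta> \<zeta>)" using F(3) by blast
    have "N x \<le> C \<zeta> * N (shift T \<mu> x)" using C(3) \<zeta> mx F(1) by blast
    also have "\<dots> \<le> B * N (shift T \<mu> x)"
      by (rule mult_right_mono[OF B[OF \<zeta>(1)]]) (rule N_nonneg[OF shift_in[OF T mx(2)]])
    finally show "N x \<le> B * N (shift T \<mu> x)" .
  qed
qed

text \<open>This is the resolvent identity: applying \<open>\<zeta> - T\<close> to the difference of
  the two resolvent values leaves \<open>(\<mu> - \<zeta>)\<close> times the second value. Each of
  the two inversions contributes one factor \<open>C\<close>.\<close>

lemma resolvent_Lipschitz:
  assumes T: "bounded_op T" and reg: "regular T \<zeta>" "regular T \<mu>" and y: "y \<in> X" and C: "C > 0"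
    and bd: "\<And>x. x \<in> X \<Longrightarrow> N x \<le> C * N (shift T \<zeta> x)" "\<And>x. x \<in> X \<Longrightarrow> N x \<le> C * N (shift T \<mu> x)"
  shows "N (resolvent T \<zeta> y - resolvent T \<mu> y) \<le> C\<^sup>2 * N y * cmod (\<zeta> - \<mu>)"
proof -
  define a b where "a = resolvent T \<zeta> y" and "b = resolvent T \<mu> y"
  have ab: "a \<in> X" "b \<in> X" "shift T \<zeta> a = y" "shift T \<mu> b = y"
    using resolvent_in shift_resolvent reg y by (auto simp: a_def b_def)
  have "shift T \<zeta> b = shift T \<mu> b + (\<zeta> - \<mu>) \<odot> b"
    by (simp add: shift_def scale_left_diff_distrib)
  then have "shift T \<zeta> (a - b) = - ((\<zeta> - \<mu>) \<odot> b)"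
    using bounded_op_diff[OF bounded_op_shift[OF T] ab(1,2)] ab by simp
  then have "N (a - b) \<le> C * (cmod (\<zeta> - \<mu>) * N b)"
    using bd(1)[of "a - b"] ab N_minus N_scale by simp
  also have "\<dots> \<le> C * (cmod (\<zeta> - \<mu>) * (C * N y))"
    using bd(2)[OF ab(2)] C ab by (intro mult_left_mono) auto
  finally show ?thesis by (simp add: a_def b_def power2_eq_square mult_ac)
qed

text \<open>On doubling the number of nodes the old nodes reappear as the even ones. Consecutive
  means therefore differ by an average of increments over half a mesh, which is of geometric size.
  The limit plays the part of the integral of \<open>F\<close> over the unit interval.\<close>

lemma dyadic_mean_convergent:
  fixes F :: "real \<Rightarrow> 'v"
  assumes F: "\<And>t. F t \<in> X" and L: "\<And>s t. N (F s - F t) \<le> L * \<bar>s - t\<bar>"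
  shows "\<exists>h\<in>X. (\<lambda>j. N ((1 / 2 ^ j) \<odot> (\<Sum>k<2^j. F (real k / 2 ^ j)) - h)) \<longlonglongrightarrow> 0"
proof (rule geometric_convergent)
  have L0: "L \<ge> 0" using L[of 0 1] N_nonneg[of "F 0 - F 1"] F by simp
  have split: "(\<Sum>k<2*n. g k) = (\<Sum>k<n. g (2*k) + g (2*k+1))" for g :: "nat \<Rightarrow> 'v" and n
    by (induction n) (auto simp: add.assoc)
  fix j :: nat
  show "(1 / 2 ^ j) \<odot> (\<Sum>k<2^j. F (real k / 2 ^ j)) \<in> X" by (intro X_closed F)
  let ?G = "\<lambda>k. F (real (2*k+1) / 2 ^ Suc j) - F (real k / 2 ^ j)"
  have "(1 / 2 ^ Suc j) \<odot> (\<Sum>k<2^Suc j. F (real k / 2 ^ Suc j))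
      - (1 / 2 ^ j) \<odot> (\<Sum>k<2^j. F (real k / 2 ^ j))
      = (1 / 2 ^ Suc j) \<odot> ((\<Sum>k<2*2^j. F (real k / 2 ^ Suc j)) - (2::complex) \<odot> (\<Sum>k<2^j. F (real k / 2 ^ j)))"
    by (simp add: scale_right_diff_distrib)
  also have "(2::complex) \<odot> z = z + z" for z
    using scale_left_distrib[of 1 1 z] by simp
  also have "(\<Sum>k<2*2^j. F (real k / 2 ^ Suc j)) - ((\<Sum>k<2^j. F (real k / 2 ^ j)) + (\<Sum>k<2^j. F (real k / 2 ^ j)))
      = (\<Sum>k<2^j. ?G k)"
    by (simp add: split sum.distrib sum_subtractf)
  finally have eq: "(1 / 2 ^ Suc j) \<odot> (\<Sum>k<2^Suc j. F (real k / 2 ^ Suc j))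
      - (1 / 2 ^ j) \<odot> (\<Sum>k<2^j. F (real k / 2 ^ j)) = (1 / 2 ^ Suc j) \<odot> (\<Sum>k<2^j. ?G k)" .
  have "N (\<Sum>k<2^j. ?G k) \<le> (\<Sum>k<(2::nat)^j. N (?G k))" by (intro N_sum_le X_closed F)
  also have "\<dots> \<le> (\<Sum>k<(2::nat)^j. L * (1 / 2 ^ Suc j))"
  proof (rule sum_mono)
    fix k
    have "real (2*k+1) / 2 ^ Suc j - real k / 2 ^ j = 1 / 2 ^ Suc j" by (simp add: field_simps)
    then show "N (?G k) \<le> L * (1 / 2 ^ Suc j)"
      using L[of "real (2*k+1) / 2 ^ Suc j" "real k / 2 ^ j"] by simp
  qed
  also have "\<dots> = L / 2" by simp
  finally have sum_le: "N (\<Sum>k<2^j. ?G k) \<le> L / 2" .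
  have "N ((1 / 2 ^ Suc j) \<odot> (\<Sum>k<2^j. ?G k)) = (1 / 2 ^ Suc j) * N (\<Sum>k<2^j. ?G k)"
    by (subst N_scale) (simp_all add: F norm_divide norm_mult norm_power)
  also have "\<dots> \<le> (1 / 2 ^ Suc j) * (L / 2)"
    by (intro mult_left_mono sum_le) simp
  also have "\<dots> \<le> L * (1 / 2) ^ j" using L0 by (simp add: field_simps)
  finally show "N ((1 / 2 ^ Suc j) \<odot> (\<Sum>k<2^Suc j. F (real k / 2 ^ Suc j))
      - (1 / 2 ^ j) \<odot> (\<Sum>k<2^j. F (real k / 2 ^ j))) \<le> L * (1 / 2) ^ j"
    unfolding eq .
qed

end

section \<open>Means over roots of unity\<close>

lemma norm_cis_diff_le: "cmod (cis a - cis b) \<le> \<bar>a - b\<bar>"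
proof -
  have "cis a - cis b = cis b * (cis (a - b) - 1)" by (simp add: algebra_simps cis_mult)
  then have "cmod (cis a - cis b) = 2 * \<bar>sin ((a - b) / 2)\<bar>"
    using dist_exp_i_1[of "a - b"] by (simp add: norm_mult cis_conv_exp)
  also have "\<dots> \<le> \<bar>a - b\<bar>" using abs_sin_x_le_abs_x[of "(a - b) / 2"] by simp
  finally show ?thesis .
qed

text \<open>The nodes are the \<open>2^j\<close>-th roots of unity scaled to radius
  \<open>\<rho>\<close>: discrete orthogonality applies to them, and they are nested in
  \<open>j\<close>.\<close>

definition dyadic_point :: "real \<Rightarrow> nat \<Rightarrow> nat \<Rightarrow> complex" where
  "dyadic_point \<rho> j k = of_real \<rho> * cis (2 * pi * (real k / 2 ^ j))"

text \<open>Averaging over the \<open>2^j\<close>-th roots of unity annihilates the powers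
  \<open>z^n\<close> with \<open>0 < n < 2^j\<close>, so only the constant term and a Taylor tail
  remain. The primitive root \<open>w j\<close> is left open so that its inverse can be used as
  well.\<close>

lemma root_mean_tendsto:
  assumes H: "H holomorphic_on ball 0 R" and r: "0 \<le> r" "r < R"
    and w: "\<And>j. cmod (w j) = 1" "\<And>j. w j ^ (2^j) = 1" "\<And>j n. 0 < n \<Longrightarrow> n < 2^j \<Longrightarrow> w j ^ n \<noteq> 1"
  shows "(\<lambda>j. (1 / 2^j) * (\<Sum>k<2^j. H (of_real r * w j ^ k))) \<longlonglongrightarrow> H 0"
proof -
  define a where "a n = (deriv ^^ n) H 0 / fact n" for n
  have sums: "(\<lambda>n. a n * z ^ n) sums H z" if "cmod z < R" for z
    using holomorphic_power_series[OF H, of z] that by (simp add: a_def)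
  \<comment> \<open>Convergence at a slightly larger radius gives absolute convergence at
    \<open>r\<close>, which makes the tails \<open>E\<close> tend to 0.\<close>
  obtain r' where r': "r < r'" "r' < R" using r dense by blast
  have "summable (\<lambda>n. a n * of_real r' ^ n)" using sums[of "of_real r'"] r r' by (auto dest: sums_summable)
  then have sm: "summable (\<lambda>n. cmod (a n) * r ^ n)"
    using powser_insidea[of a "of_real r'" "of_real r"] r r' by (simp add: norm_mult norm_power)
  define E where "E L = (\<Sum>n. cmod (a (n + L)) * r ^ (n + L))" for L
  have E: "E L = (\<Sum>n. cmod (a n) * r ^ n) - (\<Sum>n<L. cmod (a n) * r ^ n)" for L
    unfolding E_def using suminf_minus_initial_segment[OF sm] by simp
  have "E \<longlonglongrightarrow> 0"
    unfolding E using tendsto_diff[OF tendsto_const summable_LIMSEQ[OF sm], of "\<Sum>n. cmod (a n) * r ^ n"]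
    by simp
  moreover have "filterlim (\<lambda>j. (2::nat) ^ j) sequentially sequentially"
    by (rule filterlim_subseq) (auto simp: strict_mono_def)
  ultimately have E0: "(\<lambda>j. E (2^j)) \<longlonglongrightarrow> 0" by (rule filterlim_compose)
  have tail: "cmod (H z - (\<Sum>n<L. a n * z ^ n)) \<le> E L" if z: "cmod z = r" for z L
  proof -
    have "H z - (\<Sum>n<L. a n * z ^ n) = (\<Sum>n. a (n + L) * z ^ (n + L))"
      using suminf_minus_initial_segment[of "\<lambda>n. a n * z ^ n" L] sums[of z] z r
      by (simp add: sums_iff)
    also have "cmod \<dots> \<le> (\<Sum>n. cmod (a (n + L) * z ^ (n + L)))"
      using sm z by (intro summable_norm) (subst summable_iff_shift, simp add: norm_mult norm_power)
    also have "\<dots> = E L" by (simp add: E_def norm_mult norm_power z)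
    finally show ?thesis .
  qed
  have poly: "(1 / 2^j) * (\<Sum>k<2^j. \<Sum>n<2^j. a n * (of_real r * w j ^ k) ^ n) = H 0" for j
  proof -
    have *: "(\<Sum>k<2^j. (w j ^ n) ^ k) = (if n = 0 then 2^j else 0)" if "n < 2^j" for n
    proof (cases "n = 0")
      case False
      have "(w j ^ n) ^ 2^j = (w j ^ 2^j) ^ n" by (simp flip: power_mult add: mult.commute)
      then show ?thesis
        using geometric_sum[of "w j ^ n" "2^j"] w(3)[of n j] w(2)[of j] that False by simp
    qed simp
    have "(\<Sum>k<2^j. \<Sum>n<2^j. a n * (of_real r * w j ^ k) ^ n)
        = (\<Sum>n<2^j. a n * of_real r ^ n * (\<Sum>k<2^j. (w j ^ n) ^ k))"
      by (subst sum.swap) (simp add: sum_distrib_left power_mult_distrib mult_ac flip: power_mult)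
    also have "\<dots> = (\<Sum>n<(2::nat)^j. if n = 0 then a 0 * 2^j else 0)"
      using * by (intro sum.cong) auto
    also have "\<dots> = a 0 * 2^j" by (subst sum.delta) auto
    finally show ?thesis by (simp add: a_def)
  qed
  have bd: "cmod ((1 / 2^j) * (\<Sum>k<2^j. H (of_real r * w j ^ k)) - H 0) \<le> E (2^j)" for j
  proof -
    have "(1 / 2^j) * (\<Sum>k<2^j. H (of_real r * w j ^ k)) - H 0 =
       (1 / 2^j) * (\<Sum>k<2^j. H (of_real r * w j ^ k) - (\<Sum>n<2^j. a n * (of_real r * w j ^ k) ^ n))"
      unfolding poly[of j, symmetric] by (simp add: sum_subtractf right_diff_distrib)
    also have "cmod \<dots> = (1 / 2^j) * cmod (\<Sum>k<2^j. H (of_real r * w j ^ k) - (\<Sum>n<2^j. a n * (of_real r * w j ^ k) ^ n))"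
      by (simp add: norm_mult norm_divide norm_power)
    also have "\<dots> \<le> (1 / 2^j) * (\<Sum>k<(2::nat)^j. E (2^j))"
      using r w(1) by (intro mult_left_mono sum_norm_le tail) (auto simp: norm_mult norm_power)
    finally show ?thesis by simp
  qed
  show ?thesis
    by (rule Lim_transform_bound[of "\<lambda>j. _ j - _" "\<lambda>j. E (2^j)", THEN LIM_zero_cancel])
       (use bd E0 in \<open>auto intro!: always_eventually order_trans[OF _ abs_ge_self]\<close>)
qed

lemma dyadic_root:
  defines "w \<equiv> \<lambda>j::nat. cis (2 * pi / 2 ^ j)"
  shows "w j ^ (2^j) = 1" and "0 < n \<Longrightarrow> n < 2^j \<Longrightarrow> w j ^ n \<noteq> 1"
    and "dyadic_point \<rho> j k = of_real \<rho> * w j ^ k"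
proof -
  have pow: "w j ^ n = cis (2 * pi * (real n / 2 ^ j))" for n
    unfolding w_def Complex.DeMoivre by (simp add: mult_ac)
  show "w j ^ (2^j) = 1" unfolding pow by simp
  show "dyadic_point \<rho> j k = of_real \<rho> * w j ^ k" by (simp add: pow dyadic_point_def)
  show "w j ^ n \<noteq> 1" if n: "0 < n" "n < 2^j"
  proof
    assume "w j ^ n = 1"
    then have "exp (2 * of_real pi * \<i> * of_nat n / of_nat (2^j)) = 1"
      by (simp add: pow cis_conv_exp mult_ac)
    then have "2^j dvd n" using complex_root_unity_eq_1[of "2^j" n] by simp
    then show False using n by (auto dest: dvd_imp_le)
  qed
qed

lemma dyadic_mean_inside:
  assumes "H holomorphic_on ball 0 R" "0 \<le> \<rho>" "\<rho> < R"
  shows "(\<lambda>j. (1 / 2^j) * (\<Sum>k<2^j. H (dyadic_point \<rho> j k))) \<longlonglongrightarrow> H 0"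
  using root_mean_tendsto[OF assms, of "\<lambda>j. cis (2 * pi / 2 ^ j)"] dyadic_root by simp

text \<open>The inverted nodes lie on the circle of radius \<open>1 / \<rho>\<close> and are powers
  of another primitive root. For a function of \<open>\<zeta>\<close> expressed through
  \<open>1 / \<zeta>\<close>, the limit is the value at infinity.\<close>

lemma dyadic_mean_outside:
  assumes "H holomorphic_on ball 0 R" "0 < \<rho>" "1 / \<rho> < R"
  shows "(\<lambda>j. (1 / 2^j) * (\<Sum>k<2^j. H (inverse (dyadic_point \<rho> j k)))) \<longlonglongrightarrow> H 0"
  using root_mean_tendsto[OF assms(1) _ assms(3), of "\<lambda>j. inverse (cis (2 * pi / 2 ^ j))"] assms(2)
    dyadic_root
  by (simp add: norm_inverse power_inverse inverse_eq_1_iff divide_inverse del: cis_inverse)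

text \<open>Since no power of \<open>b\<close> is 1, its angle is an irrational multiple of the full
  turn, and Kronecker's density theorem for fractional parts applies.\<close>

lemma powers_dense_circle:
  assumes b: "cmod b = 1" "\<And>n::nat. n \<ge> 1 \<Longrightarrow> b ^ n \<noteq> 1" and w: "cmod w = 1" and e: "e > 0"
  shows "\<exists>k::nat. cmod (b ^ k - w) < e"
proof -
  obtain \<theta> where \<theta>: "b = cis (2 * pi * \<theta>)"
    using rcis_cmod_Arg[of b] b(1) by (intro that[of "Arg b / (2 * pi)"]) (simp add: rcis_def)
  obtain \<alpha> where \<alpha>: "w = cis (2 * pi * \<alpha>)"
    using rcis_cmod_Arg[of w] w by (intro that[of "Arg w / (2 * pi)"]) (simp add: rcis_def)
  have "\<theta> \<notin> \<rat>"
  proof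
    assume "\<theta> \<in> \<rat>"
    then obtain p q where pq: "q > 0" "\<theta> = of_int p / of_int q" by (rule Rats_cases') auto
    have "b ^ nat q = cis (2 * pi * of_int p)"
      unfolding \<theta> Complex.DeMoivre using pq by simp
    then have "b ^ nat q = 1" by simp
    moreover have "nat q \<ge> 1" using pq by simp
    ultimately show False using b(2) by blast
  qed
  then obtain h k where hk: "k > 0" "\<bar>of_int k * \<theta> - of_int h - \<alpha>\<bar> < e / (2 * pi)"
    by (rule sequence_of_fractional_parts_is_dense[of \<theta> "e / (2 * pi)" \<alpha>]) (use e in auto)
  have "b ^ nat k = cis (2 * pi * (of_int k * \<theta>))"
    unfolding \<theta> Complex.DeMoivre using hk by (simp add: mult_ac)
  \<comment> \<open>The integer \<open>h\<close> from the approximation is a number of full turns,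
    so it may be added to the angle of \<open>w\<close>.\<close>
  moreover have "w = cis (2 * pi * (of_int h + \<alpha>))"
    by (simp add: \<alpha> distrib_left flip: cis_mult)
  ultimately have "cmod (b ^ nat k - w) \<le> \<bar>2 * pi * (of_int k * \<theta>) - 2 * pi * (of_int h + \<alpha>)\<bar>"
    using norm_cis_diff_le by simp
  also have "\<dots> = 2 * pi * \<bar>of_int k * \<theta> - of_int h - \<alpha>\<bar>"
    by (simp add: abs_mult diff_diff_eq flip: right_diff_distrib)
  also have "\<dots> < e" using hk by (simp add: field_simps)
  finally show ?thesis by blast
qed

lemma norm_dyadic_point: "\<rho> \<ge> 0 \<Longrightarrow> cmod (dyadic_point \<rho> j k) = \<rho>"
  by (simp add: dyadic_point_def norm_mult)

context carrier_banach
begin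

text \<open>A substitute for an operator-valued contour integral: with \<open>u(\<zeta>) = \<zeta> / (l - \<zeta>)\<close> one has
  \<open>(l - T) u(\<zeta>) R(\<zeta>) = \<zeta> R(\<zeta>) + u(\<zeta>)\<close>, and the dyadic Riemann sums of \<open>u(\<zeta>) R(\<zeta>) y\<close>
  converge in norm because the integrand is Lipschitz; \<open>h\<close> is their limit.\<close>

lemma resolvent_mean:
  assumes T: "bounded_op T" and \<rho>: "\<rho> > 0" and reg: "\<And>\<zeta>. cmod \<zeta> = \<rho> \<Longrightarrow> regular T \<zeta>"
    and l: "cmod l \<noteq> \<rho>" and y: "y \<in> X"
  defines "P \<equiv> dyadic_point \<rho>"
  shows "\<exists>h\<in>X. (\<lambda>j. N ((1 / 2 ^ j) \<odot> (\<Sum>k<2^j. P j k \<odot> resolvent T (P j k) y)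
           + ((1 / 2 ^ j) * (\<Sum>k<2^j. P j k / (l - P j k))) \<odot> y - shift T l h)) \<longlonglongrightarrow> 0"
proof -
  \<comment> \<open>The circle is compact, so one lower-bound constant serves all resolvents on
    it.\<close>
  obtain C where C: "C > 0" "\<And>\<zeta> x. cmod \<zeta> = \<rho> \<Longrightarrow> x \<in> X \<Longrightarrow> N x \<le> C * N (shift T \<zeta> x)"
    using regular_compact_bound[OF T, of "sphere 0 \<rho>"] reg by auto
  define d where "d = \<bar>cmod l - \<rho>\<bar>"
  have d: "d > 0" using l by (simp add: d_def)
  have ld: "cmod (l - \<zeta>) \<ge> d" if "cmod \<zeta> = \<rho>" for \<zeta>
    using norm_triangle_ineq3[of l \<zeta>] that by (simp add: d_def)
  define u where "u \<zeta> = \<zeta> / (l - \<zeta>)" for \<zeta>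
  have u_bound: "cmod (u \<zeta>) \<le> \<rho> / d" if "cmod \<zeta> = \<rho>" for \<zeta>
    using ld[OF that] that d \<rho> by (simp add: u_def norm_divide frac_le)
  have u_Lip: "cmod (u \<zeta> - u \<mu>) \<le> cmod l / d\<^sup>2 * cmod (\<zeta> - \<mu>)" if \<zeta>\<mu>: "cmod \<zeta> = \<rho>" "cmod \<mu> = \<rho>" for \<zeta> \<mu>
  proof -
    have ne: "l - \<zeta> \<noteq> 0" "l - \<mu> \<noteq> 0" using ld[of \<zeta>] ld[of \<mu>] \<zeta>\<mu> d by auto
    then have "u \<zeta> - u \<mu> = l * (\<zeta> - \<mu>) / ((l - \<zeta>) * (l - \<mu>))"
      by (simp add: u_def divide_simps) (simp add: algebra_simps)
    then have "cmod (u \<zeta> - u \<mu>) = cmod l * cmod (\<zeta> - \<mu>) / (cmod (l - \<zeta>) * cmod (l - \<mu>))"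
      by (simp add: norm_mult norm_divide)
    also have "\<dots> \<le> cmod l * cmod (\<zeta> - \<mu>) / (d * d)"
      using ld[OF \<zeta>\<mu>(1)] ld[OF \<zeta>\<mu>(2)] d ne
      by (intro divide_left_mono mult_mono mult_pos_pos) auto
    finally show ?thesis by (simp add: power2_eq_square)
  qed
  let ?R = "\<lambda>\<zeta>. resolvent T \<zeta> y"
  have RX: "?R \<zeta> \<in> X" if "cmod \<zeta> = \<rho>" for \<zeta> using resolvent_in reg that y by blast
  have RN: "N (?R \<zeta>) \<le> C * N y" if "cmod \<zeta> = \<rho>" for \<zeta>
    using C(2)[OF that RX[OF that]] shift_resolvent[OF reg[OF that] y] by simp
  \<comment> \<open>The Lipschitz constant of a product: bound of \<open>u\<close> times Lipschitz
    constant of the resolvent, plus Lipschitz constant of \<open>u\<close> times bound of the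
    resolvent.\<close>
  define M where "M = \<rho> / d * (C\<^sup>2 * N y) + cmod l / d\<^sup>2 * (C * N y)"
  have Ny: "N y \<ge> 0" using N_nonneg[OF y] .
  have G_Lip: "N (u \<zeta> \<odot> ?R \<zeta> - u \<mu> \<odot> ?R \<mu>) \<le> M * cmod (\<zeta> - \<mu>)"
    if \<zeta>\<mu>: "cmod \<zeta> = \<rho>" "cmod \<mu> = \<rho>" for \<zeta> \<mu>
  proof -
    have "u \<zeta> \<odot> ?R \<zeta> - u \<mu> \<odot> ?R \<mu> = u \<zeta> \<odot> (?R \<zeta> - ?R \<mu>) + (u \<zeta> - u \<mu>) \<odot> ?R \<mu>"
      by (simp add: algebra_simps)
    then have "N (u \<zeta> \<odot> ?R \<zeta> - u \<mu> \<odot> ?R \<mu>) \<le> N (u \<zeta> \<odot> (?R \<zeta> - ?R \<mu>)) + N ((u \<zeta> - u \<mu>) \<odot> ?R \<mu>)"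
      using N_triangle RX \<zeta>\<mu> by simp
    also have "\<dots> = cmod (u \<zeta>) * N (?R \<zeta> - ?R \<mu>) + cmod (u \<zeta> - u \<mu>) * N (?R \<mu>)"
      using RX \<zeta>\<mu> by (simp add: N_scale)
    also have "\<dots> \<le> \<rho> / d * (C\<^sup>2 * N y * cmod (\<zeta> - \<mu>)) + (cmod l / d\<^sup>2 * cmod (\<zeta> - \<mu>)) * (C * N y)"
      using \<zeta>\<mu> \<rho> d RX
      by (intro add_mono mult_mono u_bound u_Lip RN resolvent_Lipschitz[OF T reg reg y C(1) C(2) C(2)])
        (auto intro: N_nonneg)
    also have "\<dots> = M * cmod (\<zeta> - \<mu>)" by (simp add: M_def algebra_simps)
    finally show ?thesis .
  qed
  \<comment> \<open>This parametrises the circle by the unit interval; its values at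
    \<open>k / 2^j\<close> are the points \<open>P j k\<close>.\<close>
  define p where "p t = of_real \<rho> * cis (2 * pi * t)" for t
  have np: "cmod (p t) = \<rho>" for t using \<rho> by (simp add: p_def norm_mult)
  have p_Lip: "cmod (p s - p t) \<le> \<rho> * (2 * pi) * \<bar>s - t\<bar>" for s t
  proof -
    have "p s - p t = of_real \<rho> * (cis (2 * pi * s) - cis (2 * pi * t))"
      by (simp add: p_def algebra_simps)
    then have "cmod (p s - p t) = \<rho> * cmod (cis (2 * pi * s) - cis (2 * pi * t))"
      using \<rho> by (simp add: norm_mult)
    also have "\<dots> \<le> \<rho> * \<bar>2 * pi * s - 2 * pi * t\<bar>"
      using \<rho> norm_cis_diff_le by (intro mult_left_mono) auto
    also have "\<bar>2 * pi * s - 2 * pi * t\<bar> = 2 * pi * \<bar>s - t\<bar>"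
      by (simp add: abs_mult flip: right_diff_distrib)
    finally show ?thesis by (simp add: mult.assoc)
  qed
  have M: "M \<ge> 0" using C d \<rho> Ny by (simp add: M_def)
  have "\<exists>h\<in>X. (\<lambda>j. N ((1 / 2 ^ j) \<odot> (\<Sum>k<2^j. u (p (real k / 2 ^ j)) \<odot> ?R (p (real k / 2 ^ j))) - h)) \<longlonglongrightarrow> 0"
  proof (rule dyadic_mean_convergent[of "\<lambda>t. u (p t) \<odot> ?R (p t)"])
    show "u (p t) \<odot> ?R (p t) \<in> X" for t using RX np by simp
    show "N (u (p s) \<odot> ?R (p s) - u (p t) \<odot> ?R (p t)) \<le> (M * (\<rho> * (2 * pi))) * \<bar>s - t\<bar>" for s t
      using order_trans[OF G_Lip[OF np np] mult_left_mono[OF p_Lip M]] by (simp add: mult.assoc)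
  qed
  then obtain h where h: "h \<in> X"
    "(\<lambda>j. N ((1 / 2 ^ j) \<odot> (\<Sum>k<2^j. u (P j k) \<odot> ?R (P j k)) - h)) \<longlonglongrightarrow> 0"
    by (auto simp: P_def dyadic_point_def p_def)
  have nP: "cmod (P j k) = \<rho>" for j k using \<rho> by (simp add: P_def norm_dyadic_point)
  define S where "S j = (1 / 2 ^ j) \<odot> (\<Sum>k<2^j. u (P j k) \<odot> ?R (P j k))" for j
  have SX: "S j \<in> X" for j unfolding S_def using RX nP by simp
  have shift_u: "shift T l (u \<zeta> \<odot> ?R \<zeta>) = \<zeta> \<odot> ?R \<zeta> + u \<zeta> \<odot> y" if "cmod \<zeta> = \<rho>" for \<zeta>
  proof -
    have ne: "l - \<zeta> \<noteq> 0" using ld[OF that] d by auto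
    have "shift T l (?R \<zeta>) = shift T \<zeta> (?R \<zeta>) + (l - \<zeta>) \<odot> ?R \<zeta>"
      by (simp add: shift_def scale_left_diff_distrib)
    then have "shift T l (u \<zeta> \<odot> ?R \<zeta>) = u \<zeta> \<odot> (y + (l - \<zeta>) \<odot> ?R \<zeta>)"
      using bounded_op_scale[OF bounded_op_shift[OF T] RX[OF that]]
        shift_resolvent[OF reg[OF that] y] by simp
    then show ?thesis using ne by (simp add: scale_right_distrib u_def add.commute)
  qed
  have "shift T l (S j) = (1 / 2 ^ j) \<odot> (\<Sum>k<2^j. P j k \<odot> ?R (P j k))
           + ((1 / 2 ^ j) * (\<Sum>k<2^j. u (P j k))) \<odot> y" for j
  proof -
    have "shift T l (S j) = (1 / 2 ^ j) \<odot> (\<Sum>k<2^j. shift T l (u (P j k) \<odot> ?R (P j k)))"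
      unfolding S_def using RX nP bounded_op_scale[OF bounded_op_shift[OF T]]
        bounded_op_sum[OF bounded_op_shift[OF T], of "{..<2^j}" "\<lambda>k. u (P j k) \<odot> ?R (P j k)"]
      by simp
    also have "\<dots> = (1 / 2 ^ j) \<odot> (\<Sum>k<2^j. P j k \<odot> ?R (P j k) + u (P j k) \<odot> y)"
      using shift_u nP by simp
    finally show ?thesis
      by (simp add: sum.distrib scale_right_distrib scale_sum_left sum_distrib_left scale_sum_right)
  qed
  moreover have "(\<lambda>j. N (shift T l (S j) - shift T l h)) \<longlonglongrightarrow> 0"
    using bounded_op_tendsto[OF bounded_op_shift[OF T] SX h(1)] h(2) by (simp add: S_def)
  ultimately show ?thesis using h(1) by (auto simp: u_def)
qed

end

section \<open>Weighted composition operators\<close>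

lemma carrier_banach_of_subspace_holD:
  assumes "banach_subspace_holD X N"
  shows "carrier_banach (\<lambda>c f z. c * f z) X N"
proof -
  interpret vector_space "\<lambda>(c::complex) (f::complex \<Rightarrow> complex) z. c * f z"
    by standard (auto simp: fun_eq_iff algebra_simps)
  note X = assms[unfolded banach_subspace_holD_def]
  show ?thesis
  proof
    show "subspace X"
      using X by (simp add: subspace_def zero_fun_def plus_fun_def)
    show "\<exists>x\<in>X. (\<lambda>n. N (s n - x)) \<longlonglongrightarrow> 0"
      if "\<And>n. s n \<in> X" "\<And>e. e > 0 \<Longrightarrow> \<exists>M. \<forall>m\<ge>M. \<forall>n\<ge>M. N (s m - s n) < e" for s
    proof -
      have "(\<forall>n. s n \<in> X) \<longrightarrow> (\<forall>e>0. \<exists>M. \<forall>m\<ge>M. \<forall>n\<ge>M. N (\<lambda>z. s m z - s n z) < e) \<longrightarrow>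
          (\<exists>f\<in>X. (\<lambda>n. N (\<lambda>z. s n z - f z)) \<longlonglongrightarrow> 0)"
        using X by blast
      then show ?thesis using that by (simp add: fun_diff_def)
    qed
  qed (use X in \<open>simp_all add: zero_fun_def plus_fun_def\<close>)
qed

locale weighted_composition =
  fixes X :: "(complex \<Rightarrow> complex) set"
    and N :: "(complex \<Rightarrow> complex) \<Rightarrow> real"
    and m :: "complex \<Rightarrow> complex"
    and \<beta> :: complex
    and T :: "(complex \<Rightarrow> complex) \<Rightarrow> (complex \<Rightarrow> complex)"
  assumes subspace_holD: "banach_subspace_holD X N"
    and one_in: "onD (\<lambda>z. 1) \<in> X"
    and shift_iff: "\<And>f f1. f \<in> holD \<Longrightarrow> f1 \<in> holD \<Longrightarrow> (\<forall>z\<in>discD. f z = z * f1 z)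
               \<Longrightarrow> (f \<in> X \<longleftrightarrow> f1 \<in> X)"
    and m_hol: "m holomorphic_on discD"
    and norm_beta: "cmod \<beta> = 1"
    and T_def: "\<And>f. T f = onD (\<lambda>z. m z * f (\<beta> * z))"
    and T_bdd: "bounded_op_on X N T"
begin

sublocale carrier_banach "\<lambda>c f z. c * f z" X N
  by (rule carrier_banach_of_subspace_holD[OF subspace_holD])

lemma in_holD: "f \<in> X \<Longrightarrow> f \<in> holD"
  using subspace_holD by (auto simp: banach_subspace_holD_def)

lemma holD_hol: "f \<in> holD \<Longrightarrow> f holomorphic_on discD"
  by (simp add: holD_def)

lemma open_discD: "open discD" and zero_in_discD: "0 \<in> discD"
  by (simp_all add: discD_def)

lemma beta_discD_iff: "\<beta> * z \<in> discD \<longleftrightarrow> z \<in> discD"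
  by (simp add: discD_def norm_mult norm_beta)

lemma holD_eqI:
  assumes "f \<in> holD" "g \<in> holD" "\<And>z. z \<in> discD \<Longrightarrow> f z = g z"
  shows "f = g"
proof
  show "f z = g z" for z using assms by (cases "z \<in> discD") (auto simp: holD_def)
qed

lemma T_bounded: "bounded_op T"
  using T_bdd unfolding bounded_op_def bounded_op_on_def
  by (simp add: plus_fun_def)

lemma shift_apply: "z \<in> discD \<Longrightarrow> shift T l f z = l * f z - m z * f (\<beta> * z)"
  by (simp add: shift_def T_def onD_def)

lemma point_bound:
  assumes "compact K" "K \<subseteq> discD"
  obtains C where "\<And>f z. f \<in> X \<Longrightarrow> z \<in> K \<Longrightarrow> cmod (f z) \<le> C * N f"
proof -
  have "\<exists>C. \<forall>f\<in>X. \<forall>z\<in>K. cmod (f z) \<le> C * N f"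
    using subspace_holD assms by (simp add: banach_subspace_holD_def)
  then show thesis using that by blast
qed

text \<open>A bijective \<open>shift T l\<close> has a bounded inverse by
  \<open>bounded_inverse\<close>, and that inverse is linear because \<open>shift T l\<close> is
  linear and injective. The bounded operator demanded by \<open>op_spectrum\<close> thus comes for
  free.\<close>

lemma op_spectrum_eq: "op_spectrum X N T = {l. \<not> regular T l}"
proof -
  have "(\<exists>S. bounded_op_on X N S \<and> (\<forall>f\<in>X. S (\<lambda>z. l * f z - T f z) = f) \<and>
       (\<forall>f\<in>X. (\<lambda>z. l * S f z - T (S f) z) = f)) \<longleftrightarrow> regular T l" (is "?L \<longleftrightarrow> _") for l
  proof
    assume ?L
    then obtain S where S: "bounded_op_on X N S" "\<And>f. f \<in> X \<Longrightarrow> S (shift T l f) = f"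
       "\<And>f. f \<in> X \<Longrightarrow> shift T l (S f) = f"
      by (auto simp: shift_def fun_diff_def)
    then show "regular T l"
      unfolding regular_def
      by (intro bij_betwI[where g = S]) (auto simp: bounded_op_on_def shift_in[OF T_bounded])
  next
    assume reg: "regular T l"
    let ?A = "shift T l"
    define S where "S = resolvent T l"
    have A: "bounded_op ?A" by (rule bounded_op_shift[OF T_bounded])
    have inj: "x = y" if "?A x = ?A y" "x \<in> X" "y \<in> X" for x y
      using reg that unfolding regular_def bij_betw_def by (blast dest: inj_onD)
    have SX: "S f \<in> X" if "f \<in> X" for f using resolvent_in[OF reg that] by (simp add: S_def)
    have AS: "?A (S f) = f" if "f \<in> X" for f using shift_resolvent[OF reg that] by (simp add: S_def)
    have SA: "S (?A f) = f" if "f \<in> X" for f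
      by (rule inj) (simp_all add: AS SX that bounded_op_in[OF A])
    obtain C where C: "\<And>x. x \<in> X \<Longrightarrow> N x \<le> C * N (?A x)"
      using bounded_inverse[OF A reg[unfolded regular_def]] by blast
    have "S (f + g) = S f + S g" if "f \<in> X" "g \<in> X" for f g
      by (rule inj) (simp_all add: AS SX that bounded_op_add[OF A])
    moreover have "S (\<lambda>z. c * f z) = (\<lambda>z. c * S f z)" if "f \<in> X" for f c
      by (rule inj) (simp_all add: AS SX that bounded_op_scale[OF A])
    moreover have "N (S f) \<le> C * N f" if "f \<in> X" for f
      using C[OF SX[OF that]] AS[OF that] by simp
    ultimately have "bounded_op_on X N S"
      unfolding bounded_op_on_def plus_fun_def using SX by blast
    then show ?L using AS SA by (auto simp: shift_def fun_diff_def)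
  qed
  then show ?thesis by (simp add: op_spectrum_def)
qed

text \<open>Every function in the range of \<open>T\<close> vanishes at \<open>z0\<close>, so the
  constant 1 is not attained.\<close>

lemma not_regular_at_zero:
  assumes "z0 \<in> discD" "m z0 = 0" shows "\<not> regular T 0"
proof
  assume reg: "regular T 0"
  have "shift T 0 (resolvent T 0 (onD (\<lambda>z. 1))) z0 = 1"
    using shift_resolvent[OF reg one_in] assms by (simp add: onD_def)
  then show False using assms by (simp add: shift_apply)
qed

text \<open>The origin is fixed by the rotation, so every function in the range of
  \<open>shift T (m 0)\<close> vanishes there, unlike the constant 1.\<close>

lemma not_regular_m0: "\<not> regular T (m 0)"
proof
  assume reg: "regular T (m 0)"
  have "shift T (m 0) (resolvent T (m 0) (onD (\<lambda>z. 1))) 0 = 1"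
    using shift_resolvent[OF reg one_in] zero_in_discD by (simp add: onD_def)
  then show False using zero_in_discD by (simp add: shift_apply)
qed

section \<open>Multiplication by z and rotation of the resolvent set\<close>

lemma times_z_in: "g \<in> X \<Longrightarrow> (\<lambda>z. z * g z) \<in> X"
proof -
  assume g: "g \<in> X"
  then have "(\<lambda>z. z * g z) \<in> holD"
    using in_holD[OF g] by (auto simp: holD_def intro!: holomorphic_intros)
  then show ?thesis using shift_iff[of "\<lambda>z. z * g z" g] in_holD[OF g] g by simp
qed

text \<open>The quotient has a removable singularity at 0, with value \<open>deriv h 0\<close>;
  \<open>shift_iff\<close> then returns it to \<open>X\<close>.\<close>

lemma divide_z:
  assumes h: "h \<in> X" and h0: "h 0 = 0"
  obtains g where "g \<in> X" "h = (\<lambda>z. z * g z)"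
proof -
  define g where "g = (\<lambda>z. if z = 0 then deriv h 0 else h z / z)"
  have hol: "h holomorphic_on discD" using holD_hol in_holD h by blast
  have "g holomorphic_on discD"
    by (rule pole_theorem_open_0[of h discD 0 g]) (use hol open_discD in \<open>auto simp: g_def h0\<close>)
  moreover have "g z = 0" if "z \<notin> discD" for z
    using that in_holD[OF h] zero_in_discD by (auto simp: g_def holD_def)
  ultimately have g: "g \<in> holD" by (simp add: holD_def)
  have eq: "h = (\<lambda>z. z * g z)" by (auto simp: g_def h0)
  then have "g \<in> X" using shift_iff[OF in_holD[OF h] g] h by simp
  with eq show thesis using that by blast
qed

lemma shift_times_z:
  "f \<in> X \<Longrightarrow> shift T (\<beta> * l) (\<lambda>z. z * f z) = (\<lambda>z. \<beta> * (z * shift T l f z))"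
  by (auto simp: shift_def T_def onD_def fun_eq_iff algebra_simps)

text \<open>Injectivity is transported through multiplication by \<open>z\<close>. For surjectivity
  the equation is multiplied by \<open>\<beta> * z\<close>, solved at \<open>\<beta> * l\<close>,
  and the solution divided by \<open>z\<close>; this is possible because
  \<open>\<beta> * l \<noteq> m 0\<close> forces the solution to vanish at 0.\<close>

lemma regular_rotate:
  assumes reg: "regular T (\<beta> * l)" shows "regular T l"
  unfolding regular_def bij_betw_def
proof
  have b0: "\<beta> \<noteq> 0" using norm_beta by auto
  have inj: "x = y" if "shift T (\<beta> * l) x = shift T (\<beta> * l) y" "x \<in> X" "y \<in> X" for x y
    using reg that unfolding regular_def bij_betw_def by (blast dest: inj_onD)
  have cancel: "f = g" if fg: "f \<in> X" "g \<in> X" "(\<lambda>z. z * f z) = (\<lambda>z. z * g z)" for f g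
  proof
    have hol: "f holomorphic_on discD" "g holomorphic_on discD"
      using holD_hol in_holD fg by blast+
    fix z show "f z = g z"
    \<comment> \<open>Cancelling \<open>z\<close> is immediate away from the origin; at the origin
      the two values agree by continuity.\<close>
    proof (cases "z = 0")
      case True
      have "((\<lambda>z. f z - g z) \<longlongrightarrow> f 0 - g 0) (at 0)"
        using hol open_discD zero_in_discD
        by (intro tendsto_diff) (auto simp: continuous_on_eq_continuous_at isCont_def
            dest!: holomorphic_on_imp_continuous_on)
      moreover have "\<forall>\<^sub>F z in at 0. f z - g z = 0"
        using fun_cong[OF fg(3)] unfolding eventually_at_filter
        by (intro always_eventually) auto
      ultimately have "f 0 - g 0 = 0"
        using tendsto_unique[OF _ _ tendsto_const[of 0]] tendsto_cong[of "\<lambda>z. f z - g z" "\<lambda>z. 0" "at 0"]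
        by (metis at_neq_bot tendsto_const tendsto_unique)
      then show ?thesis using True by simp
    qed (use fun_cong[OF fg(3), of z] in simp)
  qed
  show "inj_on (shift T l) X"
  proof (rule inj_onI)
    fix f g assume fg: "f \<in> X" "g \<in> X" "shift T l f = shift T l g"
    then have "shift T (\<beta> * l) (\<lambda>z. z * f z) = shift T (\<beta> * l) (\<lambda>z. z * g z)"
      by (simp add: shift_times_z)
    then show "f = g" using inj cancel times_z_in fg by blast
  qed
  show "shift T l ` X = X"
  proof (intro equalityI subsetI)
    fix f assume f: "f \<in> X"
    have Mf: "(\<lambda>z. \<beta> * (z * f z)) \<in> X" using X_closed(5)[OF times_z_in[OF f]] .
    define h where "h = resolvent T (\<beta> * l) (\<lambda>z. \<beta> * (z * f z))"
    have h: "h \<in> X" "shift T (\<beta> * l) h = (\<lambda>z. \<beta> * (z * f z))"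
      using resolvent_in[OF reg Mf] shift_resolvent[OF reg Mf] by (simp_all add: h_def)
    have "(\<beta> * l - m 0) * h 0 = 0"
      using fun_cong[OF h(2), of 0] zero_in_discD by (simp add: shift_apply algebra_simps)
    moreover have "\<beta> * l \<noteq> m 0" using reg not_regular_m0 by metis
    ultimately have "h 0 = 0" by simp
    then obtain g where g: "g \<in> X" "h = (\<lambda>z. z * g z)" using divide_z h(1) by blast
    have "(\<lambda>z. z * shift T l g z) = (\<lambda>z. z * f z)"
      using h(2) shift_times_z[OF g(1)] b0 by (auto simp: g(2) fun_eq_iff)
    then have "shift T l g = f" using cancel shift_in[OF T_bounded g(1)] f by blast
    then show "f \<in> shift T l ` X" using g(1) by blast
  qed (use shift_in[OF T_bounded] in blast)
qed

section \<open>Taylor coefficients at the origin\<close>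

definition D :: "nat \<Rightarrow> (complex \<Rightarrow> complex) \<Rightarrow> complex" where
  "D n f = (deriv ^^ n) f 0"

lemma X_hol: "f \<in> X \<Longrightarrow> f holomorphic_on discD"
  using holD_hol in_holD by blast

lemma D_add: "f \<in> X \<Longrightarrow> g \<in> X \<Longrightarrow> D n (f + g) = D n f + D n g"
  unfolding D_def plus_fun_def by (rule higher_deriv_add[OF X_hol X_hol open_discD zero_in_discD])

lemma D_diff: "f \<in> X \<Longrightarrow> g \<in> X \<Longrightarrow> D n (f - g) = D n f - D n g"
  unfolding D_def fun_diff_def by (rule higher_deriv_diff[OF X_hol X_hol open_discD zero_in_discD])

lemma D_scale: "f \<in> X \<Longrightarrow> D n (\<lambda>z. c * f z) = c * D n f"
  unfolding D_def by (rule higher_deriv_cmult[OF X_hol zero_in_discD open_discD])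

lemma D_sum: "(\<And>i. i \<in> I \<Longrightarrow> f i \<in> X) \<Longrightarrow> D n (sum f I) = (\<Sum>i\<in>I. D n (f i))"
proof (induction I rule: infinite_finite_induct)
  case (insert i I)
  then show ?case using D_add[of "f i" "sum f I" n] by (simp add: plus_fun_def)
qed (simp_all add: D_def zero_fun_def)

lemma D_eqI:
  assumes "f \<in> X" "g \<in> X" "\<And>n. D n f = D n g"
  shows "f = g"
proof (rule holD_eqI)
  show "f z = g z" if "z \<in> discD" for z
    using holomorphic_fun_eq_on_ball[of f 0 1 g z] X_hol assms that by (simp add: discD_def D_def)
qed (use in_holD assms in auto)

text \<open>Continuous inclusion bounds \<open>f\<close> on the circle of radius 1/2, and Cauchy's
  inequality passes the bound to the derivatives at 0. Hence norm limits may be taken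
  coefficientwise.\<close>

lemma D_bound: obtains K where "\<And>f. f \<in> X \<Longrightarrow> cmod (D n f) \<le> K * N f"
proof -
  obtain C where C: "\<And>f z. f \<in> X \<Longrightarrow> z \<in> sphere 0 (1/2) \<Longrightarrow> cmod (f z) \<le> C * N f"
    by (rule point_bound[of "sphere 0 (1/2)"]) (auto simp: discD_def)
  have "cmod (D n f) \<le> (fact n * C * 2 ^ n) * N f" if f: "f \<in> X" for f
  proof -
    have "cmod (D n f) \<le> fact n * (C * N f) / (1/2) ^ n"
      unfolding D_def
    proof (rule Cauchy_inequality)
      show "f holomorphic_on ball 0 (1/2)"
        by (rule holomorphic_on_subset[OF X_hol[OF f]]) (simp add: discD_def subset_ball)
      show "continuous_on (cball 0 (1/2)) f"
        by (rule continuous_on_subset[OF holomorphic_on_imp_continuous_on[OF X_hol[OF f]]])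
           (auto simp: discD_def)
    qed (use C f in auto)
    then show ?thesis by (simp add: power_divide mult_ac)
  qed
  then show thesis by (rule that)
qed

lemma D_tendsto:
  assumes s: "\<And>j. s j \<in> X" "x \<in> X" and lim: "(\<lambda>j. N (s j - x)) \<longlonglongrightarrow> 0"
  shows "(\<lambda>j. D n (s j)) \<longlonglongrightarrow> D n x"
proof -
  obtain K where K: "\<And>f. f \<in> X \<Longrightarrow> cmod (D n f) \<le> K * N f" using D_bound by blast
  have "(\<lambda>j. cmod (D n (s j) - D n x)) \<longlonglongrightarrow> 0"
  proof (rule LIMSEQ_0_le)
    show "cmod (D n (s j) - D n x) \<le> K * N (s j - x)" for j
      using K[of "s j - x"] s by (simp add: D_diff)
    show "(\<lambda>j. K * N (s j - x)) \<longlonglongrightarrow> 0" using tendsto_mult_left[OF lim, of K] by simp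
  qed simp
  then show ?thesis by (simp add: tendsto_norm_zero_iff LIM_zero_iff)
qed

text \<open>The factor of \<open>D k f\<close> in the Leibniz formula for \<open>D n (T f)\<close>;
  the power of \<open>\<beta>\<close> is the chain rule contribution of the rotation.\<close>

definition coef :: "nat \<Rightarrow> nat \<Rightarrow> complex" where
  "coef n k = of_nat (n choose k) * \<beta> ^ k * (deriv ^^ (n - k)) m 0"

text \<open>The Leibniz rule shows that \<open>T\<close> acts on the derivatives at 0 by a lower
  triangular matrix with diagonal entries \<open>m 0 * \<beta> ^ n\<close>. The diagonal term is
  split off for the recursions below.\<close>

lemma D_T:
  assumes f: "f \<in> X"
  shows "D n (T f) = m 0 * \<beta> ^ n * D n f + (\<Sum>k<n. coef n k * D k f)"
proof -
  have hol: "(\<lambda>z. f (\<beta> * z)) holomorphic_on discD"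
    using holomorphic_on_compose_gen[of "\<lambda>z. \<beta> * z" discD f discD] X_hol[OF f] beta_discD_iff
    by (auto simp: o_def intro!: holomorphic_intros)
  have "D n (T f) = (deriv ^^ n) (\<lambda>z. f (\<beta> * z) * m z) 0"
    unfolding D_def using hol m_hol open_discD zero_in_discD X_hol[OF bounded_op_in[OF T_bounded f]]
    by (intro higher_deriv_transform_within_open[of _ discD] holomorphic_intros) (auto simp: T_def onD_def)
  also have "\<dots> = (\<Sum>k=0..n. of_nat (n choose k) * (deriv ^^ k) (\<lambda>z. f (\<beta> * z)) 0 * (deriv ^^ (n-k)) m 0)"
    by (rule higher_deriv_mult[OF hol m_hol open_discD zero_in_discD])
  also have "\<dots> = (\<Sum>k=0..n. coef n k * D k f)"
  proof (rule sum.cong)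
    fix k
    have "(deriv ^^ k) (\<lambda>z. f (\<beta> * z)) 0 = \<beta> ^ k * (deriv ^^ k) f (\<beta> * 0)"
      by (rule higher_deriv_compose_linear[OF X_hol[OF f] open_discD open_discD zero_in_discD])
         (simp add: beta_discD_iff)
    then show "of_nat (n choose k) * (deriv ^^ k) (\<lambda>z. f (\<beta> * z)) 0 * (deriv ^^ (n-k)) m 0 = coef n k * D k f"
      by (simp add: coef_def D_def)
  qed simp
  also have "{0..n} = insert n {..<n}" by auto
  finally show ?thesis by (simp add: coef_def mult_ac)
qed

lemma D_shift:
  assumes "f \<in> X"
  shows "D n (shift T l f) = (l - m 0 * \<beta> ^ n) * D n f - (\<Sum>k<n. coef n k * D k f)"
  using assms bounded_op_in[OF T_bounded]
  by (simp add: shift_def D_diff D_scale D_T algebra_simps)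

section \<open>Triangular recursion: injectivity, resolvent coefficients and contour means\<close>

lemma norm_m0_beta: "cmod (m 0 * \<beta> ^ n) = cmod (m 0)"
  by (simp add: norm_mult norm_power norm_beta)

text \<open>The diagonal entries \<open>l - m 0 * \<beta> ^ n\<close> do not vanish, so the
  triangular system determines all derivatives at 0 successively.\<close>

lemma shift_inj_outside:
  assumes l: "cmod l > cmod (m 0)" shows "inj_on (shift T l) X"
proof (rule inj_onI)
  fix f g assume fg: "f \<in> X" "g \<in> X" "shift T l f = shift T l g"
  show "f = g"
  proof (rule D_eqI[OF fg(1,2)])
    fix n show "D n f = D n g"
    proof (induction n rule: less_induct)
      case (less n)
      have sum_eq: "(\<Sum>k<n. coef n k * D k f) = (\<Sum>k<n. coef n k * D k g)" using less by simp
      have "D n (shift T l f) = D n (shift T l g)" using fg(3) by simp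
      then have "(l - m 0 * \<beta> ^ n) * D n f = (l - m 0 * \<beta> ^ n) * D n g"
        unfolding D_shift[OF fg(1)] D_shift[OF fg(2)] sum_eq by simp
      moreover have "l \<noteq> m 0 * \<beta> ^ n" using l norm_m0_beta[of n] by auto
      ultimately show ?case by simp
    qed
  qed
qed

text \<open>By this triangular recursion the Taylor coefficients of \<open>R(\<zeta>) y\<close> are rational functions of
  \<open>\<zeta>\<close> whose poles all have modulus \<open>\<bar>m(0)\<bar>\<close>.\<close>

lemma D_resolvent:
  assumes "regular T \<zeta>" "y \<in> X"
  shows "(\<zeta> - m 0 * \<beta> ^ n) * D n (resolvent T \<zeta> y) = D n y + (\<Sum>k<n. coef n k * D k (resolvent T \<zeta> y))"
  using D_shift[OF resolvent_in[OF assms], of n \<zeta>] shift_resolvent[OF assms] by simp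

text \<open>The recursion divides only by \<open>\<zeta> - m 0 * \<beta> ^ n\<close>, which has no
  zero in the disc of radius \<open>\<bar>m 0\<bar>\<close>. So each coefficient, known on the
  circle, extends holomorphically to its interior.\<close>

lemma D_resolvent_inside:
  assumes \<rho>: "\<rho> < cmod (m 0)" and reg: "\<And>\<zeta>. cmod \<zeta> = \<rho> \<Longrightarrow> regular T \<zeta>" and y: "y \<in> X"
  shows "\<exists>H. H holomorphic_on ball 0 (cmod (m 0)) \<and> (\<forall>\<zeta>. cmod \<zeta> = \<rho> \<longrightarrow> D n (resolvent T \<zeta> y) = H \<zeta>)"
proof (induction n rule: less_induct)
  case (less n)
  then obtain H where H: "\<And>k. k < n \<Longrightarrow> H k holomorphic_on ball 0 (cmod (m 0))"
    "\<And>k \<zeta>. k < n \<Longrightarrow> cmod \<zeta> = \<rho> \<Longrightarrow> D k (resolvent T \<zeta> y) = H k \<zeta>"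
    by metis
  have ne: "\<zeta> - m 0 * \<beta> ^ n \<noteq> 0" if "cmod \<zeta> < cmod (m 0)" for \<zeta>
    using that norm_m0_beta[of n] by auto
  let ?H = "\<lambda>\<zeta>. (D n y + (\<Sum>k<n. coef n k * H k \<zeta>)) / (\<zeta> - m 0 * \<beta> ^ n)"
  have "?H holomorphic_on ball 0 (cmod (m 0))"
    using ne H(1) by (intro holomorphic_intros) auto
  moreover have "D n (resolvent T \<zeta> y) = ?H \<zeta>" if "cmod \<zeta> = \<rho>" for \<zeta>
    using D_resolvent[OF reg[OF that] y, of n] ne[of \<zeta>] that \<rho> H(2)[OF _ that]
    by (simp add: field_simps)
  ultimately show ?case by (intro exI[of _ ?H]) blast
qed

text \<open>Outside the circle the recursion is solved in \<open>w = 1 / \<zeta>\<close>, and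
  \<open>H 0\<close> is the value at infinity of \<open>\<zeta>\<close> times the coefficient. The
  radius \<open>2 / (\<rho> + \<bar>m 0\<bar>)\<close> exceeds \<open>1 / \<rho>\<close> but keeps
  \<open>w\<close> away from all zeros of \<open>1 - m 0 * \<beta> ^ n * w\<close>, and it makes
  sense even if \<open>m 0 = 0\<close>.\<close>

lemma D_resolvent_outside:
  assumes \<rho>: "cmod (m 0) < \<rho>" and reg: "\<And>\<zeta>. cmod \<zeta> = \<rho> \<Longrightarrow> regular T \<zeta>" and y: "y \<in> X"
  shows "\<exists>H. H holomorphic_on ball 0 (2 / (\<rho> + cmod (m 0))) \<and> H 0 = D n y \<and>
    (\<forall>\<zeta>. cmod \<zeta> = \<rho> \<longrightarrow> \<zeta> * D n (resolvent T \<zeta> y) = H (inverse \<zeta>))"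
proof (induction n rule: less_induct)
  case (less n)
  let ?B = "ball (0::complex) (2 / (\<rho> + cmod (m 0)))"
  from less obtain H where H: "\<And>k. k < n \<Longrightarrow> H k holomorphic_on ?B" "\<And>k. k < n \<Longrightarrow> H k 0 = D k y"
    "\<And>k \<zeta>. k < n \<Longrightarrow> cmod \<zeta> = \<rho> \<Longrightarrow> \<zeta> * D k (resolvent T \<zeta> y) = H k (inverse \<zeta>)"
    by metis
  have \<rho>0: "\<rho> > 0" using \<rho> norm_ge_zero[of "m 0"] by linarith
  have ne: "1 - m 0 * \<beta> ^ n * w \<noteq> 0" if "w \<in> ?B" for w
  proof
    assume "1 - m 0 * \<beta> ^ n * w = 0"
    then have "cmod (m 0 * \<beta> ^ n * w) = 1" by (metis eq_iff_diff_eq_0 norm_one)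
    then have "cmod (m 0) * cmod w = 1" by (simp add: norm_mult norm_power norm_beta)
    moreover have "cmod (m 0) * cmod w \<le> cmod (m 0) * (2 / (\<rho> + cmod (m 0)))"
      using that by (intro mult_left_mono) auto
    moreover have "cmod (m 0) * (2 / (\<rho> + cmod (m 0))) < 1"
      using \<rho> \<rho>0 by (simp add: field_simps add_pos_nonneg)
    ultimately show False by linarith
  qed
  \<comment> \<open>This is the recursion divided by \<open>\<zeta>\<close> and written for
    \<open>\<zeta> * D n (resolvent T \<zeta> y)\<close>; at \<open>w = 0\<close> only
    \<open>D n y\<close> survives.\<close>
  let ?H = "\<lambda>w. (D n y + w * (\<Sum>k<n. coef n k * H k w)) / (1 - m 0 * \<beta> ^ n * w)"
  have "?H holomorphic_on ?B"
    using ne H(1) by (intro holomorphic_intros) auto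
  moreover have "\<zeta> * D n (resolvent T \<zeta> y) = ?H (inverse \<zeta>)" if z: "cmod \<zeta> = \<rho>" for \<zeta>
  proof -
    have z0: "\<zeta> \<noteq> 0" using z \<rho>0 by auto
    have "\<zeta> - m 0 * \<beta> ^ n \<noteq> 0" using z \<rho> norm_m0_beta[of n] by auto
    then have ne': "1 - m 0 * \<beta> ^ n * inverse \<zeta> \<noteq> 0" using z0 by (simp add: field_simps)
    have "(\<Sum>k<n. coef n k * H k (inverse \<zeta>)) = \<zeta> * (\<Sum>k<n. coef n k * D k (resolvent T \<zeta> y))"
      using H(3)[OF _ z] by (simp add: sum_distrib_left mult_ac flip: H(3)[OF _ z])
    then have "D n y + inverse \<zeta> * (\<Sum>k<n. coef n k * H k (inverse \<zeta>))
        = (\<zeta> - m 0 * \<beta> ^ n) * D n (resolvent T \<zeta> y)"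
      using D_resolvent[OF reg[OF z] y, of n] z0 by simp
    also have "\<dots> = (1 - m 0 * \<beta> ^ n * inverse \<zeta>) * (\<zeta> * D n (resolvent T \<zeta> y))"
      using z0 by (simp add: field_simps)
    finally show ?thesis using ne' by simp
  qed
  ultimately show ?case by (intro exI[of _ ?H]) simp
qed

text \<open>The means of \<open>\<zeta>\<close> times the resolvent approximate the Riesz projection
  of the circle. If its coefficients show that it multiplies \<open>y\<close> by a scalar
  \<open>a\<close>, then the norm limit provided by \<open>resolvent_mean\<close> is identified
  coefficient by coefficient as \<open>(a + b) * y\<close>.\<close>

lemma solve_from_means:
  fixes a b :: complex
  assumes \<rho>: "\<rho> > 0" and reg: "\<And>\<zeta>. cmod \<zeta> = \<rho> \<Longrightarrow> regular T \<zeta>" and l: "cmod l \<noteq> \<rho>" and y: "y \<in> X"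
    and a: "\<And>n. (\<lambda>j. (1 / 2^j) * (\<Sum>k<2^j. dyadic_point \<rho> j k * D n (resolvent T (dyadic_point \<rho> j k) y)))
              \<longlonglongrightarrow> a * D n y"
    and b: "(\<lambda>j. (1 / 2^j) * (\<Sum>k<2^j. dyadic_point \<rho> j k / (l - dyadic_point \<rho> j k))) \<longlonglongrightarrow> b"
  shows "\<exists>h\<in>X. shift T l h = (\<lambda>z. (a + b) * y z)"
proof -
  let ?P = "dyadic_point \<rho>" and ?R = "\<lambda>\<zeta>. resolvent T \<zeta> y"
  define s where "s j = (\<lambda>z. (1 / 2 ^ j) * (\<Sum>k<2^j. (\<lambda>z. ?P j k * ?R (?P j k) z)) z)
           + (\<lambda>z. ((1 / 2 ^ j) * (\<Sum>k<2^j. ?P j k / (l - ?P j k))) * y z)" for j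
  obtain h where h: "h \<in> X" "(\<lambda>j. N (s j - shift T l h)) \<longlonglongrightarrow> 0"
    using resolvent_mean[OF T_bounded \<rho> reg l y] unfolding s_def by blast
  have PR: "(\<lambda>z. ?P j k * ?R (?P j k) z) \<in> X" "?R (?P j k) \<in> X" for j k
    using resolvent_in[OF reg y] norm_dyadic_point[of \<rho>] \<rho> by auto
  have sX: "s j \<in> X" for j unfolding s_def using PR y by (intro X_closed)
  have Ds: "D n (s j) = (1 / 2^j) * (\<Sum>k<2^j. ?P j k * D n (?R (?P j k)))
      + ((1 / 2 ^ j) * (\<Sum>k<2^j. ?P j k / (l - ?P j k))) * D n y" for n j
    unfolding s_def using PR y by (subst D_add) (simp_all only: X_closed D_scale D_sum)
  have "shift T l h = (\<lambda>z. (a + b) * y z)"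
  proof (rule D_eqI)
    fix n
    have "(\<lambda>j. D n (s j)) \<longlonglongrightarrow> a * D n y + b * D n y"
      unfolding Ds by (intro tendsto_add a tendsto_mult b tendsto_const)
    moreover have "(\<lambda>j. D n (s j)) \<longlonglongrightarrow> D n (shift T l h)"
      by (rule D_tendsto[OF sX shift_in[OF T_bounded h(1)] h(2)])
    ultimately have "D n (shift T l h) = a * D n y + b * D n y"
      by (rule LIMSEQ_unique[symmetric])
    then show "D n (shift T l h) = D n (\<lambda>z. (a + b) * y z)"
      unfolding D_scale[OF y] by (simp add: distrib_right)
  qed (use shift_in[OF T_bounded h(1)] y in simp_all)
  then show ?thesis using h(1) by blast
qed

text \<open>Here the projection is the identity, \<open>a = 1\<close>, while
  \<open>\<zeta> / (l - \<zeta>)\<close> is holomorphic up to and beyond the circle and vanishes at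
  0, so \<open>b = 0\<close>. This gives surjectivity; injectivity is the triangular
  argument.\<close>

lemma regular_outside_circle:
  assumes \<rho>: "cmod (m 0) < \<rho>" and reg: "\<And>\<zeta>. cmod \<zeta> = \<rho> \<Longrightarrow> regular T \<zeta>" and l: "\<rho> < cmod l"
  shows "regular T l"
proof -
  have \<rho>0: "\<rho> > 0" using \<rho> norm_ge_zero[of "m 0"] by linarith
  have "\<exists>h\<in>X. shift T l h = y" if y: "y \<in> X" for y
  proof -
    have "(\<lambda>j. (1 / 2^j) * (\<Sum>k<2^j. dyadic_point \<rho> j k * D n (resolvent T (dyadic_point \<rho> j k) y)))
              \<longlonglongrightarrow> 1 * D n y" for n
    proof -
      obtain H where H: "H holomorphic_on ball 0 (2 / (\<rho> + cmod (m 0)))" "H 0 = D n y"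
        "\<And>\<zeta>. cmod \<zeta> = \<rho> \<Longrightarrow> \<zeta> * D n (resolvent T \<zeta> y) = H (inverse \<zeta>)"
        using D_resolvent_outside[OF \<rho> reg y] by blast
      have "1 / \<rho> < 2 / (\<rho> + cmod (m 0))" using \<rho> \<rho>0 by (simp add: field_simps add_pos_nonneg)
      from dyadic_mean_outside[OF H(1) \<rho>0 this] show ?thesis
        using H(2,3) norm_dyadic_point[of \<rho>] \<rho>0 by simp
    qed
    moreover have "(\<lambda>j. (1 / 2^j) * (\<Sum>k<2^j. dyadic_point \<rho> j k / (l - dyadic_point \<rho> j k))) \<longlonglongrightarrow> 0"
    proof -
      have "(\<lambda>\<zeta>. \<zeta> / (l - \<zeta>)) holomorphic_on ball 0 (cmod l)" by (intro holomorphic_intros) auto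
      from dyadic_mean_inside[OF this _ l] show ?thesis using \<rho>0 by simp
    qed
    ultimately show ?thesis
      using solve_from_means[OF \<rho>0 reg _ y, of l 1 0] l by simp
  qed
  then have "shift T l ` X = X" using shift_in[OF T_bounded] by (auto simp: image_iff)
  then show ?thesis
    using shift_inj_outside[of l] \<rho> l by (simp add: regular_def bij_betw_def)
qed

text \<open>Here the projection vanishes on the constant 1, so \<open>a = 0\<close>; the choice
  \<open>l = 0\<close> makes \<open>\<zeta> / (l - \<zeta>)\<close> constantly -1, so
  \<open>b = -1\<close>. The constant 1 then lies in the range of \<open>T\<close>, which a zero of
  \<open>m\<close> forbids.\<close>

lemma m_nonzero_if_regular_circle:
  assumes \<rho>: "0 < \<rho>" "\<rho> < cmod (m 0)" and reg: "\<And>\<zeta>. cmod \<zeta> = \<rho> \<Longrightarrow> regular T \<zeta>"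
    and z0: "z0 \<in> discD"
  shows "m z0 \<noteq> 0"
proof
  assume m0: "m z0 = 0"
  let ?y = "onD (\<lambda>z. 1)"
  have a: "(\<lambda>j. (1 / 2^j) * (\<Sum>k<2^j. dyadic_point \<rho> j k * D n (resolvent T (dyadic_point \<rho> j k) ?y)))
              \<longlonglongrightarrow> 0 * D n ?y" for n
  proof -
    obtain H where H: "H holomorphic_on ball 0 (cmod (m 0))"
      "\<And>\<zeta>. cmod \<zeta> = \<rho> \<Longrightarrow> D n (resolvent T \<zeta> ?y) = H \<zeta>"
      using D_resolvent_inside[OF \<rho>(2) reg one_in] by blast
    \<comment> \<open>The extra factor \<open>\<zeta>\<close> makes the value at the centre, and
      therefore the limit of the means, equal to 0.\<close>
    have "(\<lambda>\<zeta>. \<zeta> * H \<zeta>) holomorphic_on ball 0 (cmod (m 0))" by (intro holomorphic_intros H)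
    from dyadic_mean_inside[OF this _ \<rho>(2)] show ?thesis
      using H(2) norm_dyadic_point[of \<rho>] \<rho>(1) by simp
  qed
  have b: "(\<lambda>j. (1 / 2^j) * (\<Sum>k<2^j. dyadic_point \<rho> j k / (0 - dyadic_point \<rho> j k))) \<longlonglongrightarrow> -1"
  proof -
    have "dyadic_point \<rho> j k \<noteq> 0" for j k
      using norm_dyadic_point[of \<rho> j k] \<rho>(1) by auto
    then show ?thesis by simp
  qed
  have "cmod 0 \<noteq> \<rho>" using \<rho>(1) by simp
  then obtain h where h: "shift T 0 h = (\<lambda>z. (0 + (-1)) * ?y z)"
    using solve_from_means[OF \<rho>(1) reg _ one_in a b] by metis
  have "shift T 0 h z0 = -1" unfolding h using z0 by (simp add: onD_def)
  then show False using z0 m0 by (simp add: shift_apply)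
qed

end

section \<open>Rotational symmetry of the spectrum and exclusion of circles free of spectrum\<close>

theorem theorem5p3:
  fixes X :: "(complex \<Rightarrow> complex) set"
    and N :: "(complex \<Rightarrow> complex) \<Rightarrow> real"
    and m :: "complex \<Rightarrow> complex"
    and \<beta> :: complex
    and T :: "(complex \<Rightarrow> complex) \<Rightarrow> (complex \<Rightarrow> complex)"
  assumes X: "banach_subspace_holD X N"
    and e0: "onD (\<lambda>z. 1) \<in> X"
    and e1: "\<And>f f1. f \<in> holD \<Longrightarrow> f1 \<in> holD \<Longrightarrow> (\<forall>z\<in>discD. f z = z * f1 z)
               \<Longrightarrow> (f \<in> X \<longleftrightarrow> f1 \<in> X)"
    and rot: "\<And>f b. f \<in> X \<Longrightarrow> norm b = 1 \<Longrightarrow> onD (\<lambda>z. f (b * z)) \<in> X"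
    and m_hol: "m holomorphic_on discD"
    and m_mult: "\<And>f. f \<in> X \<Longrightarrow> onD (\<lambda>z. m z * f z) \<in> X"
    and beta: "norm \<beta> = 1" "\<And>n::nat. n \<ge> 1 \<Longrightarrow> \<beta> ^ n \<noteq> 1"
    and T_def: "\<And>f. T f = onD (\<lambda>z. m z * f (\<beta> * z))"
    and T_bdd: "bounded_op_on X N T"
    and zero: "\<exists>z0\<in>discD. m z0 = 0"
  shows "op_spectrum X N T = {l. norm l \<le> op_spectral_radius X N T}"
proof -
  interpret weighted_composition X N m \<beta> T
    using X e0 e1 m_hol beta(1) T_def T_bdd by unfold_locales
  obtain z0 where z0: "z0 \<in> discD" "m z0 = 0" using zero by blast
  let ?\<sigma> = "op_spectrum X N T"
  have \<sigma>: "?\<sigma> = - {l. regular T l}" by (auto simp: op_spectrum_eq)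
  have closed: "closed ?\<sigma>" unfolding \<sigma> using open_regular[OF T_bounded] by (simp add: closed_def)
  obtain R where R: "\<And>l. cmod l > R \<Longrightarrow> regular T l" using regular_large[OF T_bounded] by blast
  have bdd: "norm l \<le> R" if "l \<in> ?\<sigma>" for l using R that unfolding \<sigma> by fastforce
  have 0: "0 \<in> ?\<sigma>" unfolding \<sigma> using not_regular_at_zero[OF z0] by simp
  \<comment> \<open>The orbit of \<open>l\<close> under multiplication by \<open>\<beta>\<close>
    stays in the spectrum by the contrapositive of \<open>regular_rotate\<close>. It is dense in the
    circle through \<open>l\<close>, and the spectrum is closed.\<close>
  have rotate: "\<mu> \<in> ?\<sigma>" if l: "l \<in> ?\<sigma>" and \<mu>: "cmod \<mu> = cmod l" for l \<mu>
  proof (cases "l = 0")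
    case False
    have pow: "\<beta> ^ k * l \<in> ?\<sigma>" for k
      by (induction k) (use l regular_rotate in \<open>auto simp: \<sigma> mult.assoc\<close>)
    have "\<exists>y\<in>?\<sigma>. dist y \<mu> < e" if "e > 0" for e
    proof -
      obtain k where k: "cmod (\<beta> ^ k - \<mu> / l) < e / cmod l"
        using powers_dense_circle[OF beta, of "\<mu> / l" "e / cmod l"] \<mu> False \<open>e > 0\<close>
        by (auto simp: norm_divide)
      have "\<beta> ^ k * l - \<mu> = (\<beta> ^ k - \<mu> / l) * l" using False by (simp add: field_simps)
      then have "dist (\<beta> ^ k * l) \<mu> = cmod (\<beta> ^ k - \<mu> / l) * cmod l"
        by (simp only: dist_norm norm_mult)
      also have "\<dots> < e / cmod l * cmod l"
        by (intro mult_strict_right_mono k) (use False in simp)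
      finally have "dist (\<beta> ^ k * l) \<mu> < e" using False by simp
      then show ?thesis using pow by blast
    qed
    then show ?thesis using closed closed_approachable by blast
  qed (use that in simp)
  \<comment> \<open>Compactness and the spectral point 0 ensure that the supremum defining the
    spectral radius is attained, at \<open>l1\<close>.\<close>
  have "compact ?\<sigma>" using closed bdd by (auto simp: compact_eq_bounded_closed bounded_iff)
  then obtain l1 where l1: "l1 \<in> ?\<sigma>" "\<And>l. l \<in> ?\<sigma> \<Longrightarrow> cmod l \<le> cmod l1"
    using compact_attains_sup[of "norm ` ?\<sigma>"] 0
      compact_continuous_image[OF continuous_on_norm[OF continuous_on_id]] by blast
  have radius: "op_spectral_radius X N T = cmod l1"
    unfolding op_spectral_radius_def using l1 by (intro cSup_eq_maximum) auto
  have "\<mu> \<in> ?\<sigma>" if \<mu>: "cmod \<mu> \<le> cmod l1" for \<mu>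
  proof (rule ccontr)
    assume "\<mu> \<notin> ?\<sigma>"
    \<comment> \<open>By rotation invariance one regular point makes its whole circle
      regular.\<close>
    then have reg: "regular T \<zeta>" if "cmod \<zeta> = cmod \<mu>" for \<zeta>
      using rotate[of \<zeta> \<mu>] that by (auto simp: \<sigma>)
    \<comment> \<open>The points \<open>l1\<close>, 0 and \<open>m 0\<close> are all spectral, so
      none of them can lie on the regular circle.\<close>
    have ne: "cmod \<mu> \<noteq> cmod l1" "cmod \<mu> \<noteq> 0" "cmod \<mu> \<noteq> cmod (m 0)"
      using reg l1(1) 0 not_regular_m0 by (auto simp: \<sigma>)
    then consider "cmod \<mu> < cmod (m 0)" | "cmod (m 0) < cmod \<mu>" by linarith
    then show False
    proof cases
      case 1
      then show False using m_nonzero_if_regular_circle[of "cmod \<mu>" z0] reg ne z0 by simp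
    next
      case 2
      \<comment> \<open>The spectral point \<open>l1\<close> lies strictly outside the circle and
        would have to be regular.\<close>
      then show False using regular_outside_circle[of "cmod \<mu>" l1] reg ne \<mu> l1(1) by (simp add: \<sigma>)
    qed
  qed
  then show ?thesis using l1(2) radius by auto
qed

end
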